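(* Consider a rectangular billiard table whose perimeter has length $1$. A billiard ball is sent out from a point $F(1)$ on the perimeter at the angle $\pi/4$ to the side, and it rebounds against the sides of the rectangle consecutively at the points $F(2), F(3), \dots$. Let $n\ge 5$ and assume that the points $F(1),\dots,F(n)$ are pairwise distinct; put $\Phi=\{F(j):1\le j\le n\}$. Let $\omega_1<\omega_2$ be the weights of the two odd segments associated with $\{F(1)\}$, let $\omega_0$ be the weight of the even segment associated with $\{F(1)\}$, and let $\omega_3<\omega_4$ be the weights of the two remaining odd segments associated with $\{F(1),F(n)\}$ (i.e. those odd segments associated with $\{F(1),F(n)\}$ other than the two associated with $\{F(1)\}$). Let $A_1$ (resp. $A_4$) be the set of all elementary segments with weight $\omega_1$ (resp. $\omega_4$). Then $$|A_1|=\frac{\omega_1-1}{2}\qquad\text{and}\qquad |A_4|=n-\frac{\omega_4-1}{2}.$$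
   Context: Definitions. A segment is an open connected subset of the perimeter of the rectangle whose two endpoints are distinct points of $\Phi$. A segment with endpoints $F(k),F(l)$ ($1\le k,l\le n$) is called even, and has weight $|k-l|$, if $k$ and $l$ have the same parity; it is called odd, and has weight $k+l$, if $k$ and $l$ have different parity. The length of a segment is the distance along the perimeter between its endpoints; a segment of length less than $\tfrac12$ is called short. A segment is elementary if no point of $\Phi$ lies in it (i.e. between its endpoints). For $\emptyset\ne V\subseteq\{F(1),F(n)\}$, a segment $I$ is associated with $V$ if either $I$ is an elementary segment having an element of $V$ as an endpoint, or $I\cap\Phi$ is a nonempty subset of $V$. It is known (and is used to make the weights in the statement well defined) that there are exactly two odd segments and exactly one even segment associated with $\{F(1)\}$, and exactly four odd segments associated with $\{F(1),F(n)\}$, and that these four odd segments have pairwise different weights. *)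

theory Defs
  imports "HOL-Analysis.Analysis"
begin

section \<open>The billiard ball\<close>

definition table :: "real \<Rightarrow> real \<Rightarrow> (real \<times> real) set" where
  "table a b = {0..a} \<times> {0..b}"

definition perimeter :: "real \<Rightarrow> real \<Rightarrow> (real \<times> real) set" where
  "perimeter a b = frontier (table a b)"

text \<open>
  Law of reflection for the velocity \<open>v\<close> at the perimeter point \<open>p\<close>. In a corner both
  components change sign, so the ball returns along the path it came from. Hence if
  \<open>F 1, \<dots>, F n\<close> are distinct, none of \<open>F 2, \<dots>, F (n - 1)\<close> is a corner.
\<close>

definition rebound :: "real \<Rightarrow> real \<Rightarrow> real \<times> real \<Rightarrow> real \<times> real \<Rightarrow> real \<times> real" where
  "rebound a b p v =
     ((if fst p = 0 \<or> fst p = a then - fst v else fst v),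
      (if snd p = 0 \<or> snd p = b then - snd v else snd v))"

text \<open>
  \<open>v k\<close> is the velocity with which the ball leaves \<open>F k\<close>. The angle \<open>\<pi>/4\<close> with the sides means
  that both components of \<open>v 1\<close> have the same absolute value, normalised to \<open>1\<close>. The value \<open>F 0\<close> is
  irrelevant.
\<close>

definition billiard_path :: "real \<Rightarrow> real \<Rightarrow> (nat \<Rightarrow> real \<times> real) \<Rightarrow> bool" where
  "billiard_path a b F \<longleftrightarrow>
     F 1 \<in> perimeter a b \<and>
     (\<exists>v. \<bar>fst (v 1)\<bar> = 1 \<and> \<bar>snd (v 1)\<bar> = 1 \<and>
        (\<forall>k\<ge>1.
           (\<exists>t>0. F (Suc k) = F k + t *\<^sub>R v k) \<and>
           open_segment (F k) (F (Suc k)) \<subseteq> interior (table a b) \<and>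
           F (Suc k) \<in> perimeter a b \<and>
           v (Suc k) = rebound a b (F (Suc k)) (v k)))"

section \<open>Segments of the perimeter\<close>

definition Phi :: "(nat \<Rightarrow> real \<times> real) \<Rightarrow> nat \<Rightarrow> (real \<times> real) set" where
  "Phi F n = F ` {1..n}"

text \<open>
  A set that is open in the perimeter has the boundary \<open>closure I - I\<close> relative to the perimeter.
  For an open arc this is the set of its endpoints. Each pair of distinct points of the perimeter
  bounds two arcs.
\<close>

definition endpoints :: "(real \<times> real) set \<Rightarrow> (real \<times> real) set" where
  "endpoints I = closure I - I"

definition segment ::
  "real \<Rightarrow> real \<Rightarrow> (nat \<Rightarrow> real \<times> real) \<Rightarrow> nat \<Rightarrow> (real \<times> real) set \<Rightarrow> bool" where
  "segment a b F n I \<longleftrightarrow>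
     openin (top_of_set (perimeter a b)) I \<and> connected I \<and>
     (\<exists>p\<in>Phi F n. \<exists>q\<in>Phi F n. p \<noteq> q \<and> endpoints I = {p, q})"

definition even_segment ::
  "real \<Rightarrow> real \<Rightarrow> (nat \<Rightarrow> real \<times> real) \<Rightarrow> nat \<Rightarrow> (real \<times> real) set \<Rightarrow> bool" where
  "even_segment a b F n I \<longleftrightarrow> segment a b F n I \<and>
     (\<exists>k\<in>{1..n}. \<exists>l\<in>{1..n}. endpoints I = {F k, F l} \<and> (even k \<longleftrightarrow> even l))"

definition odd_segment ::
  "real \<Rightarrow> real \<Rightarrow> (nat \<Rightarrow> real \<times> real) \<Rightarrow> nat \<Rightarrow> (real \<times> real) set \<Rightarrow> bool" where
  "odd_segment a b F n I \<longleftrightarrow> segment a b F n I \<and>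
     (\<exists>k\<in>{1..n}. \<exists>l\<in>{1..n}. endpoints I = {F k, F l} \<and> (even k \<longleftrightarrow> odd l))"

definition index_weight :: "nat \<Rightarrow> nat \<Rightarrow> nat" where
  "index_weight k l = (if even k \<longleftrightarrow> even l then nat \<bar>int k - int l\<bar> else k + l)"

text \<open>Meaningful for segments when \<open>F\<close> is injective on \<open>{1..n}\<close>; see \<open>weight_eq\<close> below.\<close>

definition weight :: "(nat \<Rightarrow> real \<times> real) \<Rightarrow> nat \<Rightarrow> (real \<times> real) set \<Rightarrow> nat" where
  "weight F n I =
     (THE w. \<exists>k\<in>{1..n}. \<exists>l\<in>{1..n}. endpoints I = {F k, F l} \<and> w = index_weight k l)"

definition elementary ::
  "real \<Rightarrow> real \<Rightarrow> (nat \<Rightarrow> real \<times> real) \<Rightarrow> nat \<Rightarrow> (real \<times> real) set \<Rightarrow> bool" where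
  "elementary a b F n I \<longleftrightarrow> segment a b F n I \<and> I \<inter> Phi F n = {}"

text \<open>Used for nonempty \<open>V \<subseteq> {F 1, F n}\<close>.\<close>

definition associated ::
  "real \<Rightarrow> real \<Rightarrow> (nat \<Rightarrow> real \<times> real) \<Rightarrow> nat \<Rightarrow> (real \<times> real) set \<Rightarrow> (real \<times> real) set \<Rightarrow> bool"
where
  "associated a b F n V I \<longleftrightarrow> segment a b F n I \<and>
     (elementary a b F n I \<and> endpoints I \<inter> V \<noteq> {} \<or>
      I \<inter> Phi F n \<noteq> {} \<and> I \<inter> Phi F n \<subseteq> V)"

definition even_associated ::
  "real \<Rightarrow> real \<Rightarrow> (nat \<Rightarrow> real \<times> real) \<Rightarrow> nat \<Rightarrow> (real \<times> real) set \<Rightarrow> (real \<times> real) set set"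
where
  "even_associated a b F n V = {I. even_segment a b F n I \<and> associated a b F n V I}"

definition odd_associated ::
  "real \<Rightarrow> real \<Rightarrow> (nat \<Rightarrow> real \<times> real) \<Rightarrow> nat \<Rightarrow> (real \<times> real) set \<Rightarrow> (real \<times> real) set set"
where
  "odd_associated a b F n V = {I. odd_segment a b F n I \<and> associated a b F n V I}"

definition elementary_of_weight ::
  "real \<Rightarrow> real \<Rightarrow> (nat \<Rightarrow> real \<times> real) \<Rightarrow> nat \<Rightarrow> nat \<Rightarrow> (real \<times> real) set set" where
  "elementary_of_weight a b F n w = {I. elementary a b F n I \<and> weight F n I = w}"

lemma index_weight_commute: "index_weight k l = index_weight l k"
  by (auto simp: index_weight_def)

lemma weight_eq:
  assumes inj: "inj_on F {1..n}" and kl: "k \<in> {1..n}" "l \<in> {1..n}"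
    and I: "endpoints I = {F k, F l}"
  shows "weight F n I = index_weight k l"
  unfolding weight_def
proof (rule the_equality)
  show "\<exists>k'\<in>{1..n}. \<exists>l'\<in>{1..n}. endpoints I = {F k', F l'} \<and> index_weight k l = index_weight k' l'"
    using kl I by blast
next
  fix w
  assume "\<exists>k'\<in>{1..n}. \<exists>l'\<in>{1..n}. endpoints I = {F k', F l'} \<and> w = index_weight k' l'"
  then obtain k' l' where kl': "k' \<in> {1..n}" "l' \<in> {1..n}"
    and I': "endpoints I = {F k', F l'}" and w: "w = index_weight k' l'"
    by blast
  have "F k' = F k \<and> F l' = F l \<or> F k' = F l \<and> F l' = F k"
    using I I' by (metis doubleton_eq_iff)
  then have "k' = k \<and> l' = l \<or> k' = l \<and> l' = k"
    using inj_onD[OF inj] kl kl' by metis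
  then show "w = index_weight k l"
    using w index_weight_commute by auto
qed

end

theory Submission
  imports Defs
begin

text \<open>
  Parametrise the perimeter by the circle \<open>\<real> / \<int>\<close>. Following a chord of slope \<open>1\<close> or \<open>- 1\<close> is then
  one of two fixed reflections of the circle, and these alternate because no rebound before the last
  one is in a corner. Hence \<open>F k\<close> sits at \<open>\<alpha> + k \<phi>\<close> for odd \<open>k\<close> and at \<open>\<beta> - k \<phi>\<close> for even \<open>k\<close>,
  so the oriented arc from an odd \<open>k\<close> to an even \<open>l\<close> depends, up to rotation, on \<open>k + l\<close> only.
  If \<open>F 1\<close> has a neighbour \<open>F q\<close> with \<open>q\<close> even, all arcs with \<open>k + l = q + 1\<close> are therefore
  elementary, which gives \<open>q / 2\<close> of them. The smaller weight \<open>\<omega>\<^sub>1\<close> is attained at such an arc, and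
  \<open>\<omega>\<^sub>4\<close> at an elementary odd arc ending in \<open>F n\<close>, which is the same situation for the orbit in reversed
  order.
\<close>

section \<open>Cyclic order\<close>

text \<open>On the circle \<open>\<real> / \<int>\<close>, \<open>y\<close> lies strictly inside the positively oriented arc from \<open>x\<close> to \<open>z\<close>.\<close>

definition cyc :: "real \<Rightarrow> real \<Rightarrow> real \<Rightarrow> bool" where
  "cyc x y z \<longleftrightarrow> 0 < frac (y - x) \<and> frac (y - x) < frac (z - x)"

lemma frac_diff:
  fixes u v :: real
  assumes "frac v \<le> frac u"
  shows "frac (u - v) = frac u - frac v"
proof -
  have "u - v - (frac u - frac v) = of_int (\<lfloor>u\<rfloor> - \<lfloor>v\<rfloor>)"
    by (simp add: frac_def)
  moreover have "frac u - frac v < 1"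
    using frac_lt_1[of u] frac_ge_0[of v] by linarith
  ultimately show ?thesis
    using assms by (auto simp: frac_unique_iff)
qed

lemma frac_minus_commute:
  fixes x y :: real
  assumes "0 < frac (x - y)"
  shows "frac (y - x) = 1 - frac (x - y)"
  using assms frac_neg[of "x - y"] by (auto simp: frac_gt_0_iff)

lemma cyc_rotate:
  assumes "cyc x y z"
  shows "cyc y z x"
proof -
  have "frac (z - y) = frac (z - x) - frac (y - x)"
    using frac_diff[of "y - x" "z - x"] assms by (simp add: cyc_def)
  moreover have "frac (x - y) = 1 - frac (y - x)"
    using assms by (intro frac_minus_commute) (simp add: cyc_def)
  ultimately show ?thesis
    using assms frac_lt_1[of "z - x"] by (simp add: cyc_def)
qed

lemma cyc_asym: "cyc x y z \<Longrightarrow> \<not> cyc x z y"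
  by (simp add: cyc_def)

lemma cyc_trans: "cyc x y z \<Longrightarrow> cyc x z w \<Longrightarrow> cyc x y w"
  by (simp add: cyc_def)

lemma cyc_irrefl [simp]: "\<not> cyc x x y" "\<not> cyc x y y" "\<not> cyc y x y"
  by (simp_all add: cyc_def frac_ge_0 leD)

lemma cyc_total:
  assumes "y - x \<notin> \<int>" "z - x \<notin> \<int>" "z - y \<notin> \<int>"
  shows "cyc x y z \<or> cyc x z y"
proof -
  have "frac (y - x) \<noteq> frac (z - x)"
    using frac_diff[of "y - x" "z - x"] assms by auto
  then show ?thesis
    using assms by (auto simp: cyc_def frac_gt_0_iff)
qed

lemma cyc_minus: "cyc (- x) (- y) (- z) \<longleftrightarrow> cyc z y x"
proof -
  have "cyc (- x) (- y) (- z)" if c: "cyc z y x" for x y z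
  proof -
    have "frac (x - y) = frac (x - z) - frac (y - z)"
      using frac_diff[of "y - z" "x - z"] c by (simp add: cyc_def)
    then show ?thesis
      using c by (simp add: cyc_def)
  qed
  from this[of z y x] this[of "- x" "- y" "- z"] show ?thesis by auto
qed

lemma cyc_cong:
  assumes "y - x = y' - x'" "z - x = z' - x'"
  shows "cyc x y z \<longleftrightarrow> cyc x' y' z'"
  using assms by (simp add: cyc_def)

text \<open>The map taking \<open>y\<close> to \<open>x + z - y\<close> exchanges the two ends of
  the arc. Negation reverses the orientation, and the translation by \<open>x + z\<close> brings the
  reversed arc back onto itself.\<close>

lemma cyc_flip:
  assumes "cyc x y z"
  shows "cyc x (x + z - y) z"
proof -
  have "cyc (- z) (- y) (- x)"
    using assms by (simp only: cyc_minus)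
  moreover have "x + z - y - x = - y - - z" "z - x = - x - - z" by simp_all
  ultimately show ?thesis using cyc_cong by blast
qed

lemma cyc_trans_right:
  assumes "cyc x y w" "cyc y z w"
  shows "cyc x z w"
  using cyc_trans[of w x y z] assms cyc_rotate by blast

text \<open>\<open>x + frac (y - x)\<close> represents \<open>y\<close> in the period that starts at
  \<open>x\<close>. This turns the cyclic order into real intervals, whose images are the arcs of
  the perimeter.\<close>

lemma cyc_iff_interval: "cyc x m y \<longleftrightarrow> (\<exists>u. x < u \<and> u < x + frac (y - x) \<and> m - u \<in> \<int>)"
proof
  assume c: "cyc x m y"
  have "m - (x + frac (m - x)) \<in> \<int>"
    by (simp add: frac_def algebra_simps)
  moreover have "x < x + frac (m - x)" "x + frac (m - x) < x + frac (y - x)"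
    using c by (auto simp: cyc_def)
  ultimately show "\<exists>u. x < u \<and> u < x + frac (y - x) \<and> m - u \<in> \<int>" by blast
next
  assume "\<exists>u. x < u \<and> u < x + frac (y - x) \<and> m - u \<in> \<int>"
  then obtain u where u: "x < u" "u < x + frac (y - x)" "m - u \<in> \<int>" by blast
  have "frac (m - x) = u - x"
    using u frac_lt_1[of "y - x"] by (auto simp: frac_unique_iff)
  then show "cyc x m y" using u by (simp add: cyc_def del: frac_gt_0_iff)
qed

lemma cyc_shift:
  assumes "x - x' \<in> \<int>" "z - z' \<in> \<int>"
  shows "cyc x y z \<longleftrightarrow> cyc x' y z'"
proof -
  have "frac (y - x) = frac (y - x')"
    using frac_add_int_right[of "x' - x" "y - x'"] assms(1) Ints_minus[of "x - x'"] by simp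
  moreover have "frac (z - x) = frac (z' - x')"
    using frac_add_int_right[of "(z - z') - (x - x')" "z' - x'"] Ints_diff[OF assms(2,1)]
    by (simp add: algebra_simps)
  ultimately show ?thesis by (simp add: cyc_def)
qed

section \<open>Neighbours in a zigzag\<close>

text \<open>The order of \<open>k\<close> and \<open>l\<close> matters: \<open>l\<close> follows
  \<open>k\<close> in the positive direction. Without \<open>k \<noteq> l\<close> every index would
  be adjacent to itself, since \<open>cyc x y x\<close> never holds.\<close>

definition adjacent :: "(nat \<Rightarrow> real) \<Rightarrow> nat \<Rightarrow> nat \<Rightarrow> nat \<Rightarrow> bool" where
  "adjacent t n k l \<longleftrightarrow>
     k \<in> {1..n} \<and> l \<in> {1..n} \<and> k \<noteq> l \<and> (\<forall>m\<in>{1..n}. \<not> cyc (t k) (t m) (t l))"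

text \<open>Two alternating reflections compose to rotations by opposite angles, so the two parity
  classes advance by equal steps in opposite directions. The constants are existential so that the
  property survives a change of orientation and a reversal of the indices.\<close>

definition zigzag :: "(nat \<Rightarrow> real) \<Rightarrow> nat \<Rightarrow> bool" where
  "zigzag t n \<longleftrightarrow>
     (\<forall>k\<in>{1..n}. \<forall>l\<in>{1..n}. t k - t l \<in> \<int> \<longrightarrow> k = l) \<and>
     (\<exists>\<alpha> \<beta> \<phi> :: real. \<forall>k\<in>{1..n}. t k = (if odd k then \<alpha> + real k * \<phi> else \<beta> - real k * \<phi>))"

lemma zigzagE:
  assumes "zigzag t n"
  obtains \<alpha> \<beta> \<phi> :: real where
    "\<And>k. k \<in> {1..n} \<Longrightarrow> t k = (if odd k then \<alpha> + real k * \<phi> else \<beta> - real k * \<phi>)"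
  using assms unfolding zigzag_def by metis

lemma zigzag_inj:
  assumes "zigzag t n" "k \<in> {1..n}" "l \<in> {1..n}" "k \<noteq> l"
  shows "t k - t l \<notin> \<int>"
  using assms unfolding zigzag_def by blast

lemma zigzag_minus:
  assumes "zigzag t n"
  shows "zigzag (\<lambda>k. - t k) n"
proof -
  obtain \<alpha> \<beta> \<phi> :: real where
    "\<And>k. k \<in> {1..n} \<Longrightarrow> t k = (if odd k then \<alpha> + real k * \<phi> else \<beta> - real k * \<phi>)"
    using assms by (rule zigzagE) blast
  then have "\<forall>k\<in>{1..n}. - t k = (if odd k then - \<alpha> + real k * (- \<phi>) else - \<beta> - real k * (- \<phi>))"
    by simp
  moreover have "k = l" if "k \<in> {1..n}" "l \<in> {1..n}" "- t k - - t l \<in> \<int>" for k l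
    using assms that unfolding zigzag_def by (metis minus_diff_minus Ints_minus minus_minus)
  ultimately show ?thesis unfolding zigzag_def by blast
qed

text \<open>For odd \<open>n\<close> reversal keeps the parity classes and negates \<phi>; for even
  \<open>n\<close> it exchanges the classes and keeps \<phi>. It carries results about the first
  index over to the last one.\<close>

lemma zigzag_reverse:
  assumes "zigzag t n"
  shows "zigzag (\<lambda>k. t (n + 1 - k)) n"
proof -
  obtain \<alpha> \<beta> \<phi> :: real where
    t: "\<And>k. k \<in> {1..n} \<Longrightarrow> t k = (if odd k then \<alpha> + real k * \<phi> else \<beta> - real k * \<phi>)"
    using assms by (rule zigzagE) blast
  have "k = l" if "k \<in> {1..n}" "l \<in> {1..n}" "t (n + 1 - k) - t (n + 1 - l) \<in> \<int>" for k l
  proof -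
    have "n + 1 - k \<in> {1..n}" "n + 1 - l \<in> {1..n}" using that by auto
    then have "n + 1 - k = n + 1 - l" using assms that(3) unfolding zigzag_def by blast
    then show ?thesis using that by auto
  qed
  moreover have t': "t (n + 1 - k) =
      (if odd (n + 1 - k) then \<alpha> + real (n + 1 - k) * \<phi> else \<beta> - real (n + 1 - k) * \<phi>)"
    if "k \<in> {1..n}" for k
    using that by (intro t) auto
  moreover have real: "real (n + 1 - k) = real (n + 1) - real k" if "k \<in> {1..n}" for k
    using that by (simp add: of_nat_diff)
  moreover have "\<exists>\<alpha>' \<beta>' \<phi>'. \<forall>k\<in>{1..n}.
    t (n + 1 - k) = (if odd k then \<alpha>' + real k * \<phi>' else \<beta>' - real k * \<phi>')"
  proof (cases "odd n")
    case True
    have "t (n + 1 - k) = (if odd k then (\<alpha> + real (n + 1) * \<phi>) + real k * (- \<phi>)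
        else (\<beta> - real (n + 1) * \<phi>) - real k * (- \<phi>))" if k: "k \<in> {1..n}" for k
    proof -
      have "odd (n + 1 - k) \<longleftrightarrow> odd k" using k True by auto
      then show ?thesis unfolding t'[OF k] real[OF k] by (simp add: algebra_simps)
    qed
    then show ?thesis by blast
  next
    case False
    have "t (n + 1 - k) = (if odd k then (\<beta> - real (n + 1) * \<phi>) + real k * \<phi>
        else (\<alpha> + real (n + 1) * \<phi>) - real k * \<phi>)" if k: "k \<in> {1..n}" for k
    proof -
      have "odd (n + 1 - k) \<longleftrightarrow> even k" using k False by auto
      then show ?thesis unfolding t'[OF k] real[OF k] by (simp add: algebra_simps)
    qed
    then show ?thesis by blast
  qed
  ultimately show ?thesis unfolding zigzag_def by blast
qed

lemma adjacent_minus: "adjacent (\<lambda>k. - t k) n k l \<longleftrightarrow> adjacent t n l k"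
  unfolding adjacent_def cyc_minus by auto

lemma adjacent_reverse:
  assumes "k \<in> {1..n}" "l \<in> {1..n}"
  shows "adjacent (\<lambda>k. t (n + 1 - k)) n k l \<longleftrightarrow> adjacent t n (n + 1 - k) (n + 1 - l)"
proof -
  have "(\<lambda>m. n + 1 - m) ` {1..n} = {1..n}"
  proof
    show "{1..n} \<subseteq> (\<lambda>m. n + 1 - m) ` {1..n}"
    proof
      fix m assume "m \<in> {1..n}"
      then have "m = n + 1 - (n + 1 - m)" "n + 1 - m \<in> {1..n}" by auto
      then show "m \<in> (\<lambda>m. n + 1 - m) ` {1..n}" by blast
    qed
  qed auto
  then have all: "(\<forall>m\<in>{1..n}. \<not> cyc (t (n + 1 - k)) (t m) (t (n + 1 - l))) \<longleftrightarrow>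
      (\<forall>m\<in>{1..n}. \<not> cyc (t (n + 1 - k)) (t (n + 1 - m)) (t (n + 1 - l)))"
    by (metis (no_types, lifting) imageE imageI)
  have "n + 1 - k \<in> {1..n}" "n + 1 - l \<in> {1..n}" "n + 1 - k = n + 1 - l \<longleftrightarrow> k = l"
    using assms by auto
  then show ?thesis
    unfolding adjacent_def by (simp only: assms all simp_thms)
qed

section \<open>Uniqueness of neighbours\<close>

lemma zigzag_cyc_total:
  assumes "zigzag t n" "k \<in> {1..n}" "l \<in> {1..n}" "m \<in> {1..n}" "k \<noteq> l" "k \<noteq> m" "l \<noteq> m"
  shows "cyc (t k) (t l) (t m) \<or> cyc (t k) (t m) (t l)"
  using assms by (intro cyc_total zigzag_inj) auto

text \<open>Of two different successors of \<open>k\<close>, one would lie on the arc from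
  \<open>k\<close> to the other.\<close>

lemma adjacent_right_unique:
  assumes "zigzag t n" "adjacent t n k l" "adjacent t n k m"
  shows "l = m"
  using zigzag_cyc_total[of t n k l m] assms by (auto simp: adjacent_def)

lemma adjacent_left_unique:
  assumes "zigzag t n" "adjacent t n k m" "adjacent t n l m"
  shows "k = l"
  using adjacent_right_unique[OF zigzag_minus, of t n m k l] assms by (simp add: adjacent_minus)

text \<open>A third point lies on one of the two arcs between \<open>t k\<close> and
  \<open>t l\<close>, so these cannot both be empty.\<close>

lemma adjacent_asym:
  assumes "zigzag t n" "3 \<le> n" "adjacent t n k l"
  shows "\<not> adjacent t n l k"
proof
  assume lk: "adjacent t n l k"
  have "\<exists>m\<in>{1,2,3}. m \<noteq> k \<and> m \<noteq> l" by auto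
  then obtain m where "m \<in> {1,2,3}" and m: "m \<noteq> k" "m \<noteq> l" by blast
  then have "m \<in> {1..n}" using assms by auto
  then show False
    using zigzag_cyc_total[of t n k l m] cyc_rotate assms lk m unfolding adjacent_def by metis
qed

text \<open>
  Each arc from \<open>t k\<close> to \<open>t l\<close> with \<open>k\<close> odd and \<open>k + l = q + 1\<close> is a translate of the arc from
  \<open>t 1\<close> to \<open>t q\<close>. A point \<open>t m\<close> inside the former yields a point inside the latter, by
  the translation or by the translation followed by the reflection that exchanges \<open>t 1\<close> and
  \<open>t q\<close>; one of these two points has its index in \<open>{1..n}\<close>.
\<close>

lemma adjacent_propagate:
  assumes z: "zigzag t n" and "even q" and q: "adjacent t n 1 q"
    and "odd k" and kl: "k + l = q + 1" and "1 \<le> l"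
  shows "adjacent t n k l"
proof -
  obtain \<alpha> \<beta> \<phi> :: real where
    t: "\<And>k. k \<in> {1..n} \<Longrightarrow> t k = (if odd k then \<alpha> + real k * \<phi> else \<beta> - real k * \<phi>)"
    using z by (rule zigzagE) blast
  have "q \<in> {1..n}" "1 \<in> {1..n}" using q by (auto simp: adjacent_def)
  have "even l" using assms by presburger
  have "1 \<le> k" using \<open>odd k\<close> by (cases k) auto
  then have k: "k \<in> {1..n}" and l: "l \<in> {1..n}" using \<open>q \<in> {1..n}\<close> kl \<open>1 \<le> l\<close> by auto
  have R: "real q + 1 = real k + real l" using kl by linarith
  have odd: "t j = \<alpha> + real j * \<phi>" if "j \<in> {1..n}" "odd j" for j
    using t that by auto
  have even: "t j = \<beta> - real j * \<phi>" if "j \<in> {1..n}" "even j" for j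
    using t that by auto
  note tk = odd[OF k \<open>odd k\<close>] even[OF l \<open>even l\<close>] even[OF \<open>q \<in> {1..n}\<close> \<open>even q\<close>]
    odd[OF \<open>1 \<in> {1..n}\<close> odd_one]
  have arc: "t l - t k = t q - t 1"
    using arg_cong[OF R, of "\<lambda>x. x * \<phi>"] unfolding tk by (simp add: algebra_simps)
  have no: "\<not> cyc (t 1) (t m) (t q)" if "m \<in> {1..n}" for m
    using q that by (auto simp: adjacent_def)
  have False if m: "m \<in> {1..n}" and c: "cyc (t k) (t m) (t l)" for m
  proof -
    have flip: "cyc (t k) (t k + t l - t m) (t l)" using c by (rule cyc_flip)
    have "m \<noteq> k" "m \<noteq> l" using c by auto
    \<comment> \<open>The translation moves an odd index \<open>m\<close> to
      \<open>1 + m - k\<close> and an even one to \<open>q - l + m\<close>. For odd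
      \<open>m < k\<close> or even \<open>m > l\<close> this index may leave \<open>{1..n}\<close>;
      there the reflected point is used, whose index is \<open>q - (k - m)\<close> or
      \<open>1 + m - l\<close>.\<close>
    consider "odd m" "k < m" | "odd m" "m < k" | "even m" "m < l" | "even m" "l < m"
      using \<open>m \<noteq> k\<close> \<open>m \<noteq> l\<close> by linarith
    then show False
    proof cases
      case 1
      let ?j = "1 + m - k"
      have j: "?j \<in> {1..n}" "odd ?j" using 1 m \<open>odd k\<close> \<open>1 \<le> k\<close> by auto
      have "real ?j = 1 + real m - real k" using 1 by simp
      then have "t ?j - t 1 = t m - t k"
        unfolding odd[OF j] odd[OF m 1(1)] tk by (simp add: algebra_simps)
      then show False using c no[OF j(1)] arc cyc_cong by metis
    next
      case 2
      let ?j = "q - (k - m)"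
      have "m \<ge> 1" using m by auto
      then have j: "?j \<in> {1..n}" "even ?j" "k - m \<le> q"
        using 2 kl \<open>odd k\<close> \<open>even q\<close> \<open>q \<in> {1..n}\<close> \<open>1 \<le> l\<close> by auto
      have "real ?j = real q - real k + real m" using 2 j by simp
      then have "t ?j = t q + t k - t m"
        unfolding even[OF j(1,2)] odd[OF m 2(1)] tk by (simp add: algebra_simps)
      then have "t ?j - t 1 = (t k + t l - t m) - t k"
        using arc by simp
      then show False using flip no[OF j(1)] arc cyc_cong by metis
    next
      case 3
      let ?j = "q - (l - m)"
      have j: "?j \<in> {1..n}" "even ?j" "l - m \<le> q"
        using 3 kl \<open>even l\<close> \<open>even q\<close> \<open>q \<in> {1..n}\<close> \<open>1 \<le> k\<close> m by auto
      have "real ?j = real q - real l + real m" using 3 j by simp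
      then have "t ?j = t q + t m - t l"
        unfolding even[OF j(1,2)] even[OF m 3(1)] tk by (simp add: algebra_simps)
      then have "t ?j - t 1 = t m - t k"
        using arc by simp
      then show False using c no[OF j(1)] arc cyc_cong by metis
    next
      case 4
      let ?j = "1 + m - l"
      have j: "?j \<in> {1..n}" "odd ?j" using 4 m \<open>even l\<close> \<open>1 \<le> l\<close> by auto
      have "real ?j = 1 + real m - real l" using 4 by simp
      then have "t ?j - t 1 = t l - t m"
        unfolding odd[OF j] even[OF m 4(1)] tk by (simp add: algebra_simps)
      then have "t ?j - t 1 = (t k + t l - t m) - t k" by simp
      then show False using flip no[OF j(1)] arc cyc_cong by metis
    qed
  qed
  moreover have "k \<noteq> l" using \<open>odd k\<close> \<open>even l\<close> by auto
  ultimately show ?thesis using k l unfolding adjacent_def by blast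
qed

section \<open>Counting neighbouring pairs with a given index sum\<close>

definition adjacent_pairs :: "(nat \<Rightarrow> real) \<Rightarrow> nat \<Rightarrow> nat \<Rightarrow> (nat \<times> nat) set" where
  "adjacent_pairs t n w = {(k, l). adjacent t n k l \<and> k + l = w}"

lemma adjacent_pairs_minus:
  "card (adjacent_pairs (\<lambda>k. - t k) n w) = card (adjacent_pairs t n w)"
  by (intro bij_betw_same_card[of prod.swap] bij_betw_byWitness[where f' = prod.swap])
    (auto simp: adjacent_pairs_def adjacent_minus)

text \<open>Reversal replaces both indices by their complements to \<open>n + 1\<close>, hence the
  sum \<open>w\<close> by \<open>2 * n + 2 - w\<close>. The bound on \<open>w\<close> keeps the
  subtraction of naturals exact.\<close>

lemma adjacent_pairs_reverse:
  assumes "w \<le> 2 * n + 2"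
  shows "card (adjacent_pairs (\<lambda>k. t (n + 1 - k)) n w) = card (adjacent_pairs t n (2 * n + 2 - w))"
proof (intro bij_betw_same_card[of "map_prod (\<lambda>k. n + 1 - k) (\<lambda>k. n + 1 - k)"] bij_betw_byWitness)
  let ?r = "\<lambda>k. n + 1 - k" and ?t = "\<lambda>k. t (n + 1 - k)"
  show "\<forall>p\<in>adjacent_pairs ?t n w. map_prod ?r ?r (map_prod ?r ?r p) = p"
    "\<forall>p\<in>adjacent_pairs t n (2 * n + 2 - w). map_prod ?r ?r (map_prod ?r ?r p) = p"
    by (auto simp: adjacent_pairs_def adjacent_def)
  show "map_prod ?r ?r ` adjacent_pairs ?t n w \<subseteq> adjacent_pairs t n (2 * n + 2 - w)"
  proof -
    have "adjacent t n (?r k) (?r l)" if "adjacent ?t n k l" for k l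
      using that adjacent_reverse[of k n l t] by (simp add: adjacent_def)
    then show ?thesis by (auto simp: adjacent_pairs_def adjacent_def)
  qed
  show "map_prod ?r ?r ` adjacent_pairs t n (2 * n + 2 - w) \<subseteq> adjacent_pairs ?t n w"
  proof -
    have "adjacent ?t n (?r k) (?r l)" if a: "adjacent t n k l" for k l
    proof -
      have "k \<in> {1..n}" "l \<in> {1..n}" using a by (auto simp: adjacent_def)
      then have "n + 1 - ?r k = k" "n + 1 - ?r l = l" "?r k \<in> {1..n}" "?r l \<in> {1..n}" by auto
      then show ?thesis using a adjacent_reverse[of "?r k" n "?r l" t] by simp
    qed
    moreover have "n + 1 - k + (n + 1 - l) = w"
      if "adjacent t n k l" "k + l = 2 * n + 2 - w" for k l
      using that assms by (auto simp: adjacent_def)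
    ultimately show ?thesis by (auto simp: adjacent_pairs_def)
  qed
qed

text \<open>When \<open>q\<close> follows 1, propagation yields one pair for each odd
  \<open>k < q\<close>, and no pair runs the other way round. When \<open>q\<close> precedes 1, the
  mirror image of the orbit applies.\<close>

lemma card_adjacent_pairs_first:
  assumes z: "zigzag t n" and n: "3 \<le> n" and "even q"
    and q: "adjacent t n 1 q \<or> adjacent t n q 1"
  shows "card (adjacent_pairs t n (q + 1)) = q div 2"
proof -
  have *: "card (adjacent_pairs t n (q + 1)) = q div 2"
    if z: "zigzag t n" and q: "adjacent t n 1 q" for t
  proof -
    have "1 \<le> q" using q by (auto simp: adjacent_def)
    have adj: "adjacent t n k l" if "odd k" "k + l = q + 1" "1 \<le> l" for k l
      using adjacent_propagate[OF z \<open>even q\<close> q that] .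
    have "adjacent_pairs t n (q + 1) = (\<lambda>i. (2 * i + 1, q - 2 * i)) ` {..<q div 2}"
    proof (intro equalityI subsetI)
      fix p assume "p \<in> adjacent_pairs t n (q + 1)"
      then obtain k l where p: "p = (k, l)" and a: "adjacent t n k l" and kl: "k + l = q + 1"
        by (auto simp: adjacent_pairs_def)
      have ge: "1 \<le> k" "1 \<le> l" using a by (auto simp: adjacent_def)
      \<comment> \<open>A pair starting at an even index would be the reverse of a propagated pair,
        so both arcs between the same two points would be empty.\<close>
      have "odd k"
      proof
        assume "even k"
        then have "odd l" using kl \<open>even q\<close> by presburger
        then have "adjacent t n l k" using adj[of l k] kl ge by auto
        then show False using adjacent_asym z n a by blast
      qed
      then obtain i where i: "k = 2 * i + 1" by (elim oddE)
      have "l = q - 2 * i" using kl i by linarith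
      moreover have "i < q div 2" using kl i ge \<open>even q\<close> by auto
      ultimately show "p \<in> (\<lambda>i. (2 * i + 1, q - 2 * i)) ` {..<q div 2}" using p i by auto
    next
      fix p assume "p \<in> (\<lambda>i. (2 * i + 1, q - 2 * i)) ` {..<q div 2}"
      then obtain i where i: "i < q div 2" and p: "p = (2 * i + 1, q - 2 * i)" by auto
      have "2 * i + 2 \<le> q" using i by linarith
      then show "p \<in> adjacent_pairs t n (q + 1)"
        using adj[of "2 * i + 1" "q - 2 * i"] p by (auto simp: adjacent_pairs_def)
    qed
    moreover have "inj_on (\<lambda>i. (2 * i + 1, q - 2 * i)) {..<q div 2}"
      by (auto simp: inj_on_def)
    ultimately show ?thesis by (simp add: card_image)
  qed
  show ?thesis
    using q *[OF z] *[OF zigzag_minus[OF z]] by (auto simp: adjacent_minus adjacent_pairs_minus)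
qed

text \<open>In the reversed orbit \<open>n\<close> becomes 1 and its neighbour \<open>v\<close>
  becomes the even index \<open>n + 1 - v\<close>.\<close>

lemma card_adjacent_pairs_last:
  assumes z: "zigzag t n" and n: "3 \<le> n" and "odd (n + v)"
    and v: "adjacent t n n v \<or> adjacent t n v n"
  shows "card (adjacent_pairs t n (n + v)) = (n + 1 - v) div 2"
proof -
  let ?t = "\<lambda>k. t (n + 1 - k)" and ?q = "n + 1 - v"
  have vn: "v \<in> {1..n}" using v by (auto simp: adjacent_def)
  have "even ?q" using \<open>odd (n + v)\<close> vn by auto
  moreover have "adjacent ?t n 1 ?q \<or> adjacent ?t n ?q 1"
  proof -
    have "?q \<in> {1..n}" "1 \<in> {1..n}" "n + 1 - ?q = v" using vn by auto
    then show ?thesis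
      using adjacent_reverse[of 1 n ?q t] adjacent_reverse[of ?q n 1 t] v by simp
  qed
  ultimately have "card (adjacent_pairs ?t n (?q + 1)) = ?q div 2"
    using card_adjacent_pairs_first[OF zigzag_reverse[OF z] n] by blast
  moreover have "2 * n + 2 - (?q + 1) = n + v" "?q + 1 \<le> 2 * n + 2" using vn by auto
  ultimately show ?thesis using adjacent_pairs_reverse[of "?q + 1" n t] by simp
qed

section \<open>The two extremal weights\<close>

definition enclosed :: "(nat \<Rightarrow> real) \<Rightarrow> nat \<Rightarrow> nat \<Rightarrow> nat \<Rightarrow> nat set" where
  "enclosed t n k l = {m \<in> {1..n}. cyc (t k) (t m) (t l)}"

text \<open>The index form of \<open>odd_associated\<close>, with \<open>S\<close> as the set of
  indices of the points in \<open>V\<close>. Oddness of \<open>k + l\<close> already forces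
  \<open>k\<close> and \<open>l\<close> to differ.\<close>

definition odd_pairs :: "(nat \<Rightarrow> real) \<Rightarrow> nat \<Rightarrow> nat set \<Rightarrow> (nat \<times> nat) set" where
  "odd_pairs t n S = {(k, l). k \<in> {1..n} \<and> l \<in> {1..n} \<and> odd (k + l) \<and>
     (enclosed t n k l = {} \<and> (k \<in> S \<or> l \<in> S) \<or> enclosed t n k l \<noteq> {} \<and> enclosed t n k l \<subseteq> S)}"

lemma enclosed_endpoints: "m \<in> enclosed t n k l \<Longrightarrow> k \<noteq> m \<and> l \<noteq> m"
  by (auto simp: enclosed_def)

lemma adjacent_iff_enclosed:
  "adjacent t n k l \<longleftrightarrow> k \<in> {1..n} \<and> l \<in> {1..n} \<and> k \<noteq> l \<and> enclosed t n k l = {}"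
  by (auto simp: adjacent_def enclosed_def)

lemma odd_pairs_minus: "(k, l) \<in> odd_pairs (\<lambda>k. - t k) n S \<longleftrightarrow> (l, k) \<in> odd_pairs t n S"
proof -
  have "enclosed (\<lambda>k. - t k) n k l = enclosed t n l k"
    by (simp only: enclosed_def cyc_minus)
  then show ?thesis by (auto simp: odd_pairs_def add.commute)
qed

text \<open>The only inner point splits the arc into two arcs without inner points.\<close>

lemma enclosed_singleton:
  assumes k: "k \<in> {1..n}" and l: "l \<in> {1..n}" and i: "enclosed t n k l = {x}"
  shows "adjacent t n k x" "adjacent t n x l"
proof -
  have x: "x \<in> {1..n}" "cyc (t k) (t x) (t l)" using i by (auto simp: enclosed_def)
  then have "k \<noteq> x" "x \<noteq> l" by auto
  have "m = x" if "m \<in> {1..n}" "cyc (t k) (t m) (t l)" for m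
    using i that unfolding enclosed_def by blast
  then have "m = x" if "m \<in> {1..n}" "cyc (t k) (t m) (t x) \<or> cyc (t x) (t m) (t l)" for m
    using cyc_trans[of "t k" "t m" "t x" "t l"] cyc_trans_right[of "t k" "t x" "t l" "t m"] x(2) that
    by blast
  then have "\<not> cyc (t k) (t m) (t x) \<and> \<not> cyc (t x) (t m) (t l)" if "m \<in> {1..n}" for m
    using that cyc_irrefl by blast
  then show "adjacent t n k x" "adjacent t n x l"
    using k l x(1) \<open>k \<noteq> x\<close> \<open>x \<noteq> l\<close> by (simp_all add: adjacent_def)
qed

lemma enclosed_doubleton:
  assumes k: "k \<in> {1..n}" and l: "l \<in> {1..n}" and i: "enclosed t n k l = {x, y}"
    and c: "cyc (t k) (t x) (t y)"
  shows "adjacent t n k x" "adjacent t n x y" "adjacent t n y l"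
proof -
  have x: "x \<in> {1..n}" "cyc (t k) (t x) (t l)" and y: "y \<in> {1..n}" "cyc (t k) (t y) (t l)"
    using i by (auto simp: enclosed_def)
  have xyl: "cyc (t x) (t y) (t l)"
    using cyc_trans[of "t y" "t l" "t k" "t x"] c y(2) cyc_rotate by blast
  have xy: "m = x \<or> m = y" if "m \<in> {1..n}" "cyc (t k) (t m) (t l)" for m
    using i that unfolding enclosed_def by blast
  have "enclosed t n k y = {x}"
  proof (intro equalityI subsetI)
    fix m assume "m \<in> enclosed t n k y"
    then have m: "m \<in> {1..n}" "cyc (t k) (t m) (t y)" by (auto simp: enclosed_def)
    then have "m = x \<or> m = y" using xy cyc_trans y(2) by blast
    then show "m \<in> {x}" using m by auto
  qed (use c x in \<open>simp add: enclosed_def\<close>)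
  from enclosed_singleton[OF k y(1) this] show "adjacent t n k x" "adjacent t n x y" .
  have "enclosed t n x l = {y}"
  proof (intro equalityI subsetI)
    fix m assume "m \<in> enclosed t n x l"
    then have m: "m \<in> {1..n}" "cyc (t x) (t m) (t l)" by (auto simp: enclosed_def)
    then have "m = x \<or> m = y" using xy cyc_trans_right x(2) by blast
    then show "m \<in> {y}" using m by auto
  qed (use xyl y in \<open>simp add: enclosed_def\<close>)
  from enclosed_singleton(2)[OF x(1) l this] show "adjacent t n y l" .
qed

text \<open>If the minimum came from an arc around 1 alone, its ends \<open>k\<close> and
  \<open>l\<close> would be the neighbours of 1. Exactly one of them is even, and joining it to 1
  instead of to the other end gives a smaller odd weight.\<close>

lemma min_weight_first:
  assumes n: "3 \<le> n" and w: "(\<lambda>(k, l). k + l) ` odd_pairs t n {1} = {w\<^sub>1, w\<^sub>2}" "w\<^sub>1 < w\<^sub>2"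
  obtains q where "even q" "adjacent t n 1 q \<or> adjacent t n q 1" "w\<^sub>1 = q + 1"
proof -
  have min: "w\<^sub>1 \<le> k + l" if "(k, l) \<in> odd_pairs t n {1}" for k l
  proof -
    have "k + l \<in> {w\<^sub>1, w\<^sub>2}" using w(1) that by force
    then show ?thesis using w(2) by auto
  qed
  have "w\<^sub>1 \<in> (\<lambda>(k, l). k + l) ` odd_pairs t n {1}" using w(1) by simp
  then obtain k l where kl: "(k, l) \<in> odd_pairs t n {1}" and w1: "w\<^sub>1 = k + l" by auto
  then have k: "k \<in> {1..n}" and l: "l \<in> {1..n}" and odd: "odd (k + l)"
    by (auto simp: odd_pairs_def)
  have one: "(1::nat) \<in> {1..n}" using n by auto
  have *: "(1, j) \<in> odd_pairs t n {1}" if "adjacent t n 1 j" "even j" for j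
    using that one by (auto simp: odd_pairs_def adjacent_iff_enclosed)
  have **: "(j, 1) \<in> odd_pairs t n {1}" if "adjacent t n j 1" "even j" for j
    using that one by (auto simp: odd_pairs_def adjacent_iff_enclosed)
  consider "adjacent t n k l" "k = 1" | "adjacent t n k l" "l = 1" | "enclosed t n k l = {1}"
    using kl by (auto simp: odd_pairs_def adjacent_iff_enclosed)
  then show thesis
  proof cases
    case 1
    then show ?thesis using that[of l] odd w1 by auto
  next
    case 2
    then show ?thesis using that[of k] odd w1 by auto
  next
    case 3
    note adj = enclosed_singleton[OF k l 3]
    then have "1 < k" "1 < l" using k l by (auto simp: adjacent_def)
    moreover have "w\<^sub>1 \<le> 1 + l" if "even l" using min * adj that by blast
    moreover have "w\<^sub>1 \<le> k + 1" if "even k" using min ** adj that by blast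
    ultimately show ?thesis using odd w1 by auto
  qed
qed

text \<open>
  If \<open>n\<close> is even and \<open>t 1\<close>, \<open>t n\<close> are neighbours, the arcs between \<open>t k\<close> and \<open>t (n + 1 - k)\<close>
  pair up all points, so odd and even indices alternate around the circle.
\<close>

lemma alternate_right:
  assumes z: "zigzag t n" and "even n" and a: "adjacent t n 1 n" "adjacent t n n l"
  shows "odd l"
proof
  assume "even l"
  have l: "1 \<le> l" "l \<le> n" using a by (auto simp: adjacent_def)
  then have k: "odd (n + 1 - l)" "n + 1 - l + l = n + 1"
    using \<open>even l\<close> \<open>even n\<close> by auto
  \<comment> \<open>Propagation with \<open>q = n\<close> makes the odd index
    \<open>n + 1 - l\<close> the predecessor of \<open>l\<close>, but this predecessor is the even
    index \<open>n\<close>.\<close>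
  then have "adjacent t n (n + 1 - l) l"
    using adjacent_propagate[OF z \<open>even n\<close> a(1)] l by blast
  then have "n + 1 - l = n" using adjacent_left_unique[OF z _ a(2)] by blast
  then show False using k \<open>even n\<close> by auto
qed

lemma alternate_left:
  assumes z: "zigzag t n" and "even n" and "adjacent t n n 1" "adjacent t n k n"
  shows "odd k"
  using alternate_right[OF zigzag_minus[OF z]] assms by (simp add: adjacent_minus)

text \<open>These pairs are the competitors against which the maximal weight is compared: an empty
  arc with neither end at 1 is not associated with the first point.\<close>

lemma adjacent_last_odd_pair:
  assumes "adjacent t n n v \<or> adjacent t n v n" "v \<noteq> 1" "n \<noteq> 1" "odd (n + v)"
  shows "(n, v) \<in> odd_pairs t n {1, n} - odd_pairs t n {1} \<or>
    (v, n) \<in> odd_pairs t n {1, n} - odd_pairs t n {1}"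
  using assms by (auto simp: odd_pairs_def adjacent_iff_enclosed)

text \<open>Here \<open>k\<close>, 1, \<open>n\<close>, \<open>l\<close> are consecutive. If
  \<open>n + l\<close> were odd, it would be a larger weight, as \<open>k < n\<close>. For even
  \<open>n\<close> alternation makes \<open>l\<close> odd, so \<open>n + l\<close> would be odd
  after all. Hence \<open>n\<close> and \<open>l\<close> are odd, and then every pair in
  \<open>D\<close> other than \<open>(k, l)\<close> has an even sum or an end at 1, so no second
  weight is left.\<close>

lemma no_max_weight_around_both:
  assumes z: "zigzag t n" and n: "3 \<le> n"
    and D: "D = odd_pairs t n {1, n} - odd_pairs t n {1}"
    and kl: "(k, l) \<in> D" and max: "\<And>i j. (i, j) \<in> D \<Longrightarrow> i + j \<le> k + l"
    and ij: "(i, j) \<in> D" "i + j \<noteq> k + l"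
    and both: "enclosed t n k l = {1, n}" and c: "cyc (t k) (t 1) (t n)"
  shows False
proof -
  have k: "k \<in> {1..n}" and l: "l \<in> {1..n}" and odd: "odd (k + l)"
    using kl D by (auto simp: odd_pairs_def)
  note adj = enclosed_doubleton[OF k l both c]
  have kn: "k \<noteq> n" "l \<noteq> 1"
    using enclosed_endpoints[of _ t n k l] both by auto
  have "even (n + l)"
  proof (rule ccontr)
    assume "odd (n + l)"
    then have "n + l \<le> k + l"
      using adjacent_last_odd_pair[of t n l] adj kn n max[of n l] max[of l n] D by auto
    then show False using k kn by auto
  qed
  moreover have "odd n"
  proof
    assume "even n"
    then have "odd l" using alternate_right[OF z] adj by blast
    then show False using \<open>even (n + l)\<close> \<open>even n\<close> by auto
  qed
  ultimately have "odd l" by auto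
  have i: "i \<in> {1..n}" and j: "j \<in> {1..n}" and ij_odd: "odd (i + j)"
    using ij D by (auto simp: odd_pairs_def)
  have il: "j = l" if "adjacent t n n j" using adjacent_right_unique[OF z that adj(3)] .
  have jk: "i = 1" if "adjacent t n i n" using adjacent_left_unique[OF z that adj(2)] .
  consider "adjacent t n n j" "i = n" | "adjacent t n i n" "i \<noteq> 1" | "enclosed t n i j = {n}"
    | "enclosed t n i j = {1, n}"
    using ij D by (auto simp: odd_pairs_def adjacent_iff_enclosed)
  then show False
  proof cases
    case 1
    then show False using il ij_odd \<open>odd n\<close> \<open>odd l\<close> by auto
  next
    case 2
    then show False using jk by blast
  next
    case 3
    then have "i = 1" "j = l" using enclosed_singleton[OF i j] il jk by auto
    then show False using ij_odd \<open>odd l\<close> by auto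
  next
    case 4
    have mem: "(1::nat) \<in> {1..n}" "n \<in> {1..n}" using n by auto
    have "i \<noteq> 1" "i \<noteq> n" using enclosed_endpoints[of _ t n i j] 4 by auto
    then consider "cyc (t i) (t 1) (t n)" | "cyc (t i) (t n) (t 1)"
      using zigzag_cyc_total[OF z i mem] n by auto
    then show False
    proof cases
      case 1
      note adj' = enclosed_doubleton[OF i j 4 1]
      have "i = k" using adjacent_left_unique[OF z adj'(1) adj(1)] .
      moreover have "j = l" using il adj'(3) .
      ultimately show False using ij by simp
    next
      case 2
      have "adjacent t n n 1"
        using enclosed_doubleton(2)[OF i j _ 2] 4 by (simp add: insert_commute)
      then show False using adjacent_asym[OF z n] adj(2) by blast
    qed
  qed
qed

text \<open>An arc that only encloses \<open>n\<close> can be exchanged for a heavier one ending at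
  \<open>n\<close>, unless the new end is 1, where alternation intervenes. An arc around both 1 and
  \<open>n\<close> cannot be maximal because two different weights occur.\<close>

lemma max_weight_last:
  assumes z: "zigzag t n" and n: "3 \<le> n"
    and w: "(\<lambda>(k, l). k + l) ` (odd_pairs t n {1, n} - odd_pairs t n {1}) = {w\<^sub>3, w\<^sub>4}" "w\<^sub>3 < w\<^sub>4"
  obtains v where "odd (n + v)" "adjacent t n n v \<or> adjacent t n v n" "w\<^sub>4 = n + v"
proof -
  define D where "D = odd_pairs t n {1, n} - odd_pairs t n {1}"
  have max: "k + l \<le> w\<^sub>4" if "(k, l) \<in> D" for k l
  proof -
    have "k + l \<in> {w\<^sub>3, w\<^sub>4}" using w(1) that unfolding D_def by force
    then show ?thesis using w(2) by auto
  qed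
  have "w\<^sub>4 \<in> (\<lambda>(k, l). k + l) ` D" "w\<^sub>3 \<in> (\<lambda>(k, l). k + l) ` D" using w(1) by (auto simp: D_def)
  then obtain k l i j where kl: "(k, l) \<in> D" and w4: "w\<^sub>4 = k + l"
    and ij: "(i, j) \<in> D" "w\<^sub>3 = i + j"
    by auto
  have k: "k \<in> {1..n}" and l: "l \<in> {1..n}" and odd: "odd (k + l)"
    using kl by (auto simp: odd_pairs_def D_def)
  have mem: "(1::nat) \<in> {1..n}" "n \<in> {1..n}" "n \<noteq> 1" using n by auto
  have last: "n + v \<le> k + l" if "adjacent t n n v \<or> adjacent t n v n" "v \<noteq> 1" "odd (n + v)" for v
    using adjacent_last_odd_pair[OF that(1,2) _ that(3)] mem max[of n v] max[of v n] w4
    by (auto simp: D_def)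
  consider "adjacent t n k l" "k = n" | "adjacent t n k l" "l = n" | "enclosed t n k l = {n}"
    | "enclosed t n k l = {1, n}"
    using kl by (auto simp: odd_pairs_def D_def adjacent_iff_enclosed)
  then show thesis
  proof cases
    case 1
    then show ?thesis using that[of l] odd w4 by auto
  next
    case 2
    then show ?thesis using that[of k] odd w4 by (auto simp: add.commute)
  next
    case 3
    note adj = enclosed_singleton[OF k l 3]
    have lt: "k < n" "l < n" using adj by (auto simp: adjacent_def)
    \<comment> \<open>If \<open>l\<close> differs from 1, the arc joining it to \<open>n\<close>
      outweighs \<open>k + l\<close>. If \<open>l = 1\<close>, then \<open>n\<close> is even and
      alternation makes \<open>k\<close> odd, against the oddness of \<open>k + l\<close>.\<close>
    have "False" if "odd (n + l)"
    proof (cases "l = 1")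
      case True
      then have "odd k" using alternate_left[OF z] adj that by auto
      then show False using True odd by auto
    next
      case False
      then show False using last[of l] adj that lt by auto
    qed
    moreover have "False" if "odd (n + k)"
    proof (cases "k = 1")
      case True
      then have "odd l" using alternate_right[OF z] adj that by auto
      then show False using True odd by auto
    next
      case False
      then show False using last[of k] adj that lt by auto
    qed
    ultimately show ?thesis using odd by auto
  next
    case 4
    have ne: "i + j \<noteq> k + l" using w(2) w4 ij by simp
    have "k \<noteq> 1" "k \<noteq> n" using enclosed_endpoints[of _ t n k l] 4 by auto
    then consider "cyc (t k) (t 1) (t n)" | "cyc (t k) (t n) (t 1)"
      using zigzag_cyc_total[OF z k mem(1,2)] mem by auto
    then have False
    proof cases
      case 1
      show False
        using no_max_weight_around_both[OF z n D_def kl _ ij(1) ne 4 1] max w4 by simp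
    next
      case 2
      \<comment> \<open>The order \<open>k\<close>, \<open>n\<close>, 1, \<open>l\<close> becomes
        \<open>l\<close>, 1, \<open>n\<close>, \<open>k\<close> in the mirror image, which is the
        case already excluded.\<close>
      let ?t = "\<lambda>k. - t k" and ?D = "odd_pairs (\<lambda>k. - t k) n {1, n} - odd_pairs (\<lambda>k. - t k) n {1}"
      have D: "(y, x) \<in> ?D \<longleftrightarrow> (x, y) \<in> D" for x y
        by (simp add: odd_pairs_minus D_def)
      have "1 \<in> enclosed t n k l" using 4 by simp
      then have "cyc (t k) (t 1) (t l)" by (simp add: enclosed_def)
      then have "cyc (t n) (t 1) (t l)" 
        using cyc_trans[of "t 1" "t l" "t k" "t n"] 2 cyc_rotate cyc_trans by blast
      then have "cyc (?t l) (?t 1) (?t n)" by (simp only: cyc_minus)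
      moreover have "enclosed ?t n l k = {1, n}" using 4 by (simp only: enclosed_def cyc_minus)
      moreover have "(l, k) \<in> ?D" "(j, i) \<in> ?D" using D kl ij by auto
      moreover have "y + x \<le> l + k" if "(y, x) \<in> ?D" for x y
        using that D max w4 by (simp add: add.commute)
      moreover have "j + i \<noteq> l + k" using ne by simp
      ultimately show False
        using no_max_weight_around_both[OF zigzag_minus[OF z] n refl] by blast
    qed
    then show ?thesis ..
  qed
qed

section \<open>Arcs of a parametrised circle\<close>

lemma open_connected_real_cases:
  fixes J :: "real set"
  assumes "open J" "connected J" "J \<noteq> {}" "bdd_below J" "bdd_above J"
  shows "Inf J < Sup J" "J = {Inf J<..<Sup J}"
proof -
  have lt: "Inf J < u" and gt: "u < Sup J" if u: "u \<in> J" for u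
  proof -
    obtain e where "0 < e" and e: "ball u e \<subseteq> J" using \<open>open J\<close> u by (auto simp: open_contains_ball)
    have "u - e / 2 \<in> ball u e" "u + e / 2 \<in> ball u e" using \<open>0 < e\<close> by (auto simp: dist_real_def)
    then have J: "u - e / 2 \<in> J" "u + e / 2 \<in> J" using e by auto
    have "Inf J \<le> u - e / 2" "u + e / 2 \<le> Sup J"
      using cInf_lower[OF J(1)] cSup_upper[OF J(2)] assms(4,5) by simp_all
    then show "Inf J < u" "u < Sup J" using \<open>0 < e\<close> by auto
  qed
  show "J = {Inf J<..<Sup J}"
  proof (intro equalityI subsetI)
    fix u assume "u \<in> {Inf J<..<Sup J}"
    then have u: "Inf J < u" "u < Sup J" by simp_all
    obtain l where "l \<in> J" "l < u" using cInf_lessD[OF \<open>J \<noteq> {}\<close> u(1)] by blast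
    moreover obtain r where "r \<in> J" "u < r" using less_cSupD[OF \<open>J \<noteq> {}\<close> u(2)] by blast
    ultimately show "u \<in> J"
      using \<open>connected J\<close> less_imp_le unfolding connected_iff_interval by blast
  qed (use lt gt in auto)
  show "Inf J < Sup J" using lt gt \<open>J \<noteq> {}\<close> by fastforce
qed

text \<open>\<open>g\<close> induces a continuous bijection from the circle of period 1 onto
  \<open>P\<close>. Compactness of a period makes it a homeomorphism.\<close>

locale circle_parametrization =
  fixes g :: "real \<Rightarrow> 'a :: metric_space" and P :: "'a set"
  assumes continuous: "continuous_on S g" and range: "range g = P"
    and eq_iff: "g s = g s' \<longleftrightarrow> s - s' \<in> \<int>"
begin

text \<open>The arc runs from \<open>x\<close> in the positive direction up to the first
  representative of \<open>y\<close>; it is empty when \<open>g x = g y\<close>.\<close>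

definition open_arc :: "real \<Rightarrow> real \<Rightarrow> 'a set" where
  "open_arc x y = g ` {x<..<x + frac (y - x)}"

lemma mem_arc_iff: "g m \<in> open_arc x y \<longleftrightarrow> cyc x m y"
  by (auto simp: open_arc_def eq_iff cyc_iff_interval)

lemma arc_eq: "open_arc x y = {g m |m. cyc x m y}"
proof (intro equalityI subsetI)
  fix p assume "p \<in> open_arc x y"
  moreover then obtain m where "p = g m" by (auto simp: open_arc_def)
  ultimately show "p \<in> {g m |m. cyc x m y}" using mem_arc_iff by blast
qed (auto simp: mem_arc_iff)

lemma arc_cong: "x - x' \<in> \<int> \<Longrightarrow> y - y' \<in> \<int> \<Longrightarrow> open_arc x y = open_arc x' y'"
  by (simp add: arc_eq cyc_shift[of x x' y y'])

lemma openin_image: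
  assumes "open U" "U \<subseteq> {x<..<x + 1}"
  shows "openin (top_of_set P) (g ` U)"
proof -
  let ?K = "{x..x + 1} - U"
  have "compact (g ` ?K)"
    using assms(1) by (intro compact_continuous_image continuous compact_diff) auto
  then have "open (- (g ` ?K))" by (intro open_Compl compact_imp_closed)
  moreover have "g ` U = P \<inter> - (g ` ?K)"
  proof (intro equalityI subsetI)
    fix p assume "p \<in> g ` U"
    then obtain u where u: "u \<in> U" "p = g u" by blast
    have "p \<noteq> g w" if w: "w \<in> ?K" for w
    proof
      assume "p = g w"
      then have "u - w \<in> \<int>" using u eq_iff by simp
      moreover have "\<bar>u - w\<bar> < 1" using u w assms(2) by fastforce
      ultimately have "u = w" using Ints_nonzero_abs_less1 by fastforce
      then show False using u w by blast
    qed
    then have "p \<notin> g ` ?K" by blast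
    then show "p \<in> P \<inter> - (g ` ?K)" using u(2) range by blast
  next
    fix p assume p: "p \<in> P \<inter> - (g ` ?K)"
    then obtain s where s: "p = g s" using range by blast
    define u where "u = x + frac (s - x)"
    have "s - u \<in> \<int>" by (simp add: u_def frac_def algebra_simps)
    then have "p = g u" using s eq_iff by simp
    moreover have "u \<in> {x..x + 1}" using frac_lt_1[of "s - x"] by (simp add: u_def)
    ultimately show "p \<in> g ` U" using p by blast
  qed
  ultimately show ?thesis by (auto simp: openin_open)
qed

lemma closure_image:
  assumes "c < d"
  shows "closure (g ` {c<..<d}) = g ` {c..d}"
proof
  show "closure (g ` {c<..<d}) \<subseteq> g ` {c..d}"
    by (intro closure_minimal compact_imp_closed compact_continuous_image continuous image_mono) auto
  show "g ` {c..d} \<subseteq> closure (g ` {c<..<d})"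
    using image_closure_subset[OF continuous closed_closure closure_subset, of "{c<..<d}"] assms
    by simp
qed

lemma frac_pos:
  assumes "g x \<noteq> g y"
  shows "0 < frac (y - x)"
  using assms by (simp add: eq_iff) (metis Ints_minus minus_diff_eq)

lemma openin_arc: "openin (top_of_set P) (open_arc x y)"
  unfolding open_arc_def using frac_lt_1[of "y - x"] by (intro openin_image[of _ x]) auto

lemma connected_arc: "connected (open_arc x y)"
  unfolding open_arc_def by (intro connected_continuous_image continuous) auto

lemma closure_arc_minus:
  assumes "g x \<noteq> g y"
  shows "closure (open_arc x y) - open_arc x y = {g x, g y}"
proof -
  let ?y = "x + frac (y - x)"
  have pos: "x < ?y" using frac_pos[OF assms] by linarith
  have y: "g ?y = g y" by (simp add: eq_iff frac_def)
  have "{x..?y} = insert x (insert ?y {x<..<?y})"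
    using pos by auto
  then have "closure (open_arc x y) = insert (g x) (insert (g y) (open_arc x y))"
    unfolding open_arc_def closure_image[OF pos] using y by simp
  then show ?thesis by (auto simp: mem_arc_iff)
qed

text \<open>The endpoint \<open>g x\<close> is not in \<open>I\<close>, so \<open>I\<close> lifts to
  the open period starting at \<open>x\<close>. The lift is an open interval, and its ends map to
  the endpoints of \<open>I\<close>.\<close>

lemma open_connected_is_arc:
  assumes op: "openin (top_of_set P) I" and conn: "connected I"
    and ends: "closure I - I = {g x, g y}" and ne: "g x \<noteq> g y"
  shows "I = open_arc x y \<or> I = open_arc y x"
proof -
  define J where "J = {s \<in> {x<..<x + 1}. g s \<in> I}"
  have "I \<subseteq> P" using op openin_imp_subset by blast
  obtain W where W: "open W" "I = P \<inter> W" using op by (auto simp: openin_open)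
  have "J = {x<..<x + 1} \<inter> g -` W" using W range by (auto simp: J_def)
  moreover have "open (g -` W)"
    using open_vimage[OF W(1)] continuous by blast
  ultimately have "open J" by auto
  have gJ: "g ` J = I"
  proof (intro equalityI subsetI)
    fix p assume p: "p \<in> I"
    then obtain s where s: "p = g s" using \<open>I \<subseteq> P\<close> range by blast
    have "g x \<in> closure I - I" unfolding ends by simp
    then have "g x \<noteq> g s" using p s by auto
    then have "0 < frac (s - x)" by (rule frac_pos)
    moreover have u: "p = g (x + frac (s - x))" by (simp add: s eq_iff frac_def)
    ultimately have "x + frac (s - x) \<in> J"
      using p frac_lt_1[of "s - x"] by (simp add: J_def del: frac_gt_0_iff)
    then show "p \<in> g ` J" using u by blast
  qed (auto simp: J_def)
  \<comment> \<open>On the open period \<open>g\<close> is injective and open, so a separation of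
    \<open>J\<close> would be carried to a separation of \<open>I\<close>.\<close>
  have "connected J"
  proof (rule connectedI)
    fix A B assume AB: "open A" "open B" "A \<inter> J \<noteq> {}" "B \<inter> J \<noteq> {}" "A \<inter> B \<inter> J = {}" "J \<subseteq> A \<union> B"
    have "openin (top_of_set P) (g ` (A \<inter> J))" "openin (top_of_set P) (g ` (B \<inter> J))"
      using AB \<open>open J\<close> by (intro openin_image[of _ x]; force simp: J_def)+
    then obtain A' B' where A': "open A'" "g ` (A \<inter> J) = P \<inter> A'"
      and B': "open B'" "g ` (B \<inter> J) = P \<inter> B'"
      by (auto simp: openin_open)
    have inj: "inj_on g J"
    proof (rule inj_onI)
      fix s s' assume s: "s \<in> J" "s' \<in> J" "g s = g s'"
      then have "s - s' \<in> \<int>" "\<bar>s - s'\<bar> < 1" by (auto simp: eq_iff J_def)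
      then show "s = s'" using Ints_nonzero_abs_less1 by fastforce
    qed
    have "g ` (A \<inter> J) \<inter> g ` (B \<inter> J) = g ` (A \<inter> J \<inter> (B \<inter> J))"
      using inj_on_image_Int[OF inj, of "A \<inter> J" "B \<inter> J"] by simp
    also have "\<dots> = {}" using AB by auto
    finally have "A' \<inter> B' \<inter> I = {}" using A' B' \<open>I \<subseteq> P\<close> by auto
    moreover have "I \<subseteq> A' \<union> B'" using AB(6) A' B' gJ by blast
    moreover have "A' \<inter> I \<noteq> {}" "B' \<inter> I \<noteq> {}"
      using AB(3,4) A' B' gJ \<open>I \<subseteq> P\<close> by blast+
    ultimately show False using connectedD[OF conn A'(1) B'(1)] by blast
  qed
  have "J \<noteq> {}" using gJ ends by auto
  have bdd: "bdd_below J" "bdd_above J"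
    by (auto simp: J_def intro!: bdd_belowI[of _ x] bdd_aboveI[of _ "x + 1"])
  define c d where "c = Inf J" and "d = Sup J"
  have "c < d" and J: "J = {c<..<d}"
    using open_connected_real_cases[OF \<open>open J\<close> \<open>connected J\<close> \<open>J \<noteq> {}\<close> bdd]
    by (simp_all add: c_def d_def)
  have "x \<le> c" "d \<le> x + 1"
    using \<open>J \<noteq> {}\<close> by (auto simp: c_def d_def J_def intro!: cInf_greatest cSup_least)
  have "{c..d} = insert c (insert d {c<..<d})" using \<open>c < d\<close> by auto
  then have "closure I - I \<subseteq> {g c, g d}"
    unfolding gJ[symmetric] J closure_image[OF \<open>c < d\<close>] by auto
  then have cd: "g x = g c \<and> g y = g d \<or> g x = g d \<and> g y = g c"
    using ends ne by auto
  then have "c - d \<notin> \<int>" using ne eq_iff by metis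
  \<comment> \<open>A full period must be excluded, since \<open>frac (d - c)\<close> would then be
    0 and not \<open>d - c\<close>.\<close>
  then have "d - c \<noteq> 1" by (metis Ints_1 Ints_minus minus_diff_eq)
  then have "frac (d - c) = d - c"
    using \<open>c < d\<close> \<open>x \<le> c\<close> \<open>d \<le> x + 1\<close> by (simp add: frac_eq)
  then have "I = open_arc c d" by (simp add: open_arc_def J flip: gJ)
  then show ?thesis using cd arc_cong by (simp add: eq_iff) (metis Ints_minus minus_diff_eq)
qed

text \<open>Together with \<open>arc_nonempty\<close> this distinguishes the two arcs that have the
  same endpoints.\<close>

lemma arc_disjoint: "open_arc x y \<inter> open_arc y x = {}"
proof -
  have False if p: "p \<in> open_arc x y" "p \<in> open_arc y x" for p
  proof -
    obtain m where "p = g m" using p(1) by (auto simp: open_arc_def)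
    then have "cyc x m y" "cyc y m x" using p by (simp_all add: mem_arc_iff)
    then show False using cyc_asym cyc_rotate by blast
  qed
  then show ?thesis by blast
qed

lemma arc_nonempty:
  assumes "g x \<noteq> g y"
  shows "open_arc x y \<noteq> {}"
  using frac_pos[OF assms] by (simp add: open_arc_def del: frac_gt_0_iff)

end

section \<open>The perimeter as a circle\<close>

text \<open>This is the distance from \<open>s\<close> to the nearest integer. The cosine supplies
  continuity, periodicity and evenness at once.\<close>

definition sawtooth :: "real \<Rightarrow> real" where
  "sawtooth s = arccos (cos (2 * pi * s)) / (2 * pi)"

lemma sawtooth_eq_iff: "sawtooth x = sawtooth y \<longleftrightarrow> x - y \<in> \<int> \<or> x + y \<in> \<int>"
proof -
  have "sawtooth x = sawtooth y \<longleftrightarrow> cos (2 * pi * x) = cos (2 * pi * y)"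
    by (auto simp: sawtooth_def arccos_eq_iff)
  also have "\<dots> \<longleftrightarrow> (\<exists>m\<in>\<int>. x = y + m \<or> x = - y + m)"
  proof -
    have "2 * pi * x = 2 * pi * y + 2 * m * pi \<longleftrightarrow> x = y + m"
      "2 * pi * x = - (2 * pi * y) + 2 * m * pi \<longleftrightarrow> x = - y + m" for m
    proof -
      have "2 * pi * y + 2 * m * pi = 2 * pi * (y + m)"
        "- (2 * pi * y) + 2 * m * pi = 2 * pi * (- y + m)"
        by (simp_all add: algebra_simps)
      then show "2 * pi * x = 2 * pi * y + 2 * m * pi \<longleftrightarrow> x = y + m"
        "2 * pi * x = - (2 * pi * y) + 2 * m * pi \<longleftrightarrow> x = - y + m"
        by (metis mult_cancel_left pi_neq_zero mult_eq_0_iff zero_neq_numeral)+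
    qed
    then show ?thesis by (simp add: cos_eq)
  qed
  also have "\<dots> \<longleftrightarrow> x - y \<in> \<int> \<or> x + y \<in> \<int>"
  proof
    assume "x - y \<in> \<int> \<or> x + y \<in> \<int>"
    then show "\<exists>m\<in>\<int>. x = y + m \<or> x = - y + m"
      by (elim disjE) (force intro: bexI[of _ "x - y"] bexI[of _ "x + y"])+
  qed auto
  finally show ?thesis .
qed

lemma sawtooth_eq_self: "0 \<le> s \<Longrightarrow> s \<le> 1 / 2 \<Longrightarrow> sawtooth s = s"
  by (simp add: sawtooth_def arccos_cos mult_left_le)

lemma sawtooth_minus: "sawtooth (- s) = sawtooth s"
  by (simp add: sawtooth_def)

lemma sawtooth_eq_one_minus: "1 / 2 \<le> s \<Longrightarrow> s \<le> 1 \<Longrightarrow> sawtooth s = 1 - s"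
  using sawtooth_eq_self[of "1 - s"] sawtooth_eq_iff[of s "1 - s"] by auto

lemma continuous_on_sawtooth [continuous_intros]:
  fixes f :: "'a :: t2_space \<Rightarrow> real"
  assumes "continuous_on S f"
  shows "continuous_on S (\<lambda>x. sawtooth (f x))"
  unfolding sawtooth_def by (intro continuous_intros assms) auto

text \<open>
  The perimeter of the table at unit speed, counterclockwise from the corner \<open>(0, 0)\<close>. The
  sum and the difference of the two coordinates are \<open>sawtooth s\<close> and \<open>a - sawtooth (s - a)\<close>, so
  the chords in the two diagonal directions become the reflections \<open>s \<mapsto> - s\<close> and
  \<open>s \<mapsto> 2 * a - s\<close> of the circle.
\<close>

definition boundary_point :: "real \<Rightarrow> real \<Rightarrow> real \<times> real" where
  "boundary_point a s =
     ((sawtooth s + (a - sawtooth (s - a))) / 2, (sawtooth s - (a - sawtooth (s - a))) / 2)"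

lemma boundary_point_sum: "fst (boundary_point a s) + snd (boundary_point a s) = sawtooth s"
  by (simp add: boundary_point_def field_simps)

lemma boundary_point_diff:
  "fst (boundary_point a s) - snd (boundary_point a s) = a - sawtooth (s - a)"
  by (simp add: boundary_point_def field_simps)

lemma continuous_on_boundary_point: "continuous_on S (boundary_point a)"
  unfolding boundary_point_def by (intro continuous_intros) auto

text \<open>Sum and difference of the coordinates each determine \<open>s\<close> modulo 1 up to a
  reflection. If both reflections applied, \<open>2 * a\<close> would be an integer, but it lies
  strictly between 0 and 1.\<close>

lemma boundary_point_eq_iff:
  assumes "0 < a" "a < 1 / 2"
  shows "boundary_point a s = boundary_point a s' \<longleftrightarrow> s - s' \<in> \<int>"
proof
  assume eq: "boundary_point a s = boundary_point a s'"
  have "sawtooth s = sawtooth s'" "sawtooth (s - a) = sawtooth (s' - a)"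
    using boundary_point_sum[of a s] boundary_point_sum[of a s']
      boundary_point_diff[of a s] boundary_point_diff[of a s'] eq by simp_all
  then have "s - s' \<in> \<int> \<or> s + s' \<in> \<int>" "s - s' \<in> \<int> \<or> s + s' - 2 * a \<in> \<int>"
    by (simp_all add: sawtooth_eq_iff algebra_simps)
  moreover have False if "s + s' \<in> \<int>" "s + s' - 2 * a \<in> \<int>"
    using Ints_diff[OF that] Ints_nonzero_abs_less1[of "2 * a"] assms by simp
  ultimately show "s - s' \<in> \<int>" by blast
next
  assume "s - s' \<in> \<int>"
  then have "sawtooth s = sawtooth s'" "sawtooth (s - a) = sawtooth (s' - a)"
    by (simp_all add: sawtooth_eq_iff)
  then show "boundary_point a s = boundary_point a s'"
    by (simp add: boundary_point_def)
qed

lemma interior_table: "interior (table a b) = {0<..<a} \<times> {0<..<b}"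
  by (simp add: table_def interior_Times)

lemma mem_perimeter_iff:
  assumes "0 < a" "0 < b"
  shows "p \<in> perimeter a b \<longleftrightarrow> 0 \<le> fst p \<and> fst p \<le> a \<and> 0 \<le> snd p \<and> snd p \<le> b \<and>
    (fst p \<in> {0, a} \<or> snd p \<in> {0, b})"
proof -
  obtain x y where p: "p = (x, y)" by (cases p)
  have "perimeter a b = {0..a} \<times> {0..b} - {0<..<a} \<times> {0<..<b}"
    unfolding perimeter_def frontier_def interior_table
    by (simp add: table_def closure_Times)
  then have "p \<in> perimeter a b \<longleftrightarrow>
      (0 \<le> x \<and> x \<le> a \<and> 0 \<le> y \<and> y \<le> b) \<and> \<not> (0 < x \<and> x < a \<and> 0 < y \<and> y < b)"
    by (simp add: p)
  then show ?thesis
    unfolding p by (simp add: p) (smt (verit))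
qed

lemma boundary_point_sides:
  assumes "0 < a" "a < 1 / 2"
  shows "0 \<le> s \<Longrightarrow> s \<le> a \<Longrightarrow> boundary_point a s = (s, 0)"
    and "a \<le> s \<Longrightarrow> s \<le> 1 / 2 \<Longrightarrow> boundary_point a s = (a, s - a)"
    and "1 / 2 \<le> s \<Longrightarrow> s \<le> 1 / 2 + a \<Longrightarrow> boundary_point a s = (1 / 2 + a - s, 1 / 2 - a)"
    and "1 / 2 + a \<le> s \<Longrightarrow> s \<le> 1 \<Longrightarrow> boundary_point a s = (0, 1 - s)"
  using assms sawtooth_minus[of "s - a"]
  by (simp_all add: boundary_point_def sawtooth_eq_self sawtooth_eq_one_minus field_simps)

lemma range_boundary_point:
  assumes "0 < a" "0 < b" "2 * (a + b) = 1"
  shows "range (boundary_point a) = perimeter a b"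
proof (intro equalityI subsetI)
  have a: "a < 1 / 2" and b: "b = 1 / 2 - a" using assms by auto
  note sides = boundary_point_sides[OF \<open>0 < a\<close> a]
  fix p assume "p \<in> range (boundary_point a)"
  then obtain s where "p = boundary_point a s" by blast
  moreover have "boundary_point a s = boundary_point a (frac s)"
    using boundary_point_eq_iff[OF \<open>0 < a\<close> a] by (simp add: frac_def)
  ultimately have p: "p = boundary_point a (frac s)" by simp
  have "0 \<le> frac s" "frac s \<le> 1" using frac_ge_0 frac_lt_1 less_imp_le by blast+
  then consider "0 \<le> frac s" "frac s \<le> a" | "a \<le> frac s" "frac s \<le> 1 / 2"
    | "1 / 2 \<le> frac s" "frac s \<le> 1 / 2 + a" | "1 / 2 + a \<le> frac s" "frac s \<le> 1"
    by linarith
  then show "p \<in> perimeter a b"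
    by cases (use assms a b in \<open>simp_all add: p sides mem_perimeter_iff\<close>)
next
  have a: "a < 1 / 2" and b: "b = 1 / 2 - a" using assms by auto
  note sides = boundary_point_sides[OF \<open>0 < a\<close> a]
  fix p assume p: "p \<in> perimeter a b"
  obtain x y where xy: "p = (x, y)" by (cases p)
  then have le: "0 \<le> x" "x \<le> a" "0 \<le> y" "y \<le> b" and "x = 0 \<or> x = a \<or> y = 0 \<or> y = b"
    using p assms by (auto simp: mem_perimeter_iff)
  then consider "x = 0" | "x = a" | "y = 0" | "y = b" by blast
  then have "\<exists>s. p = boundary_point a s"
  proof cases
    case 1
    then show ?thesis using sides(4)[of "1 - y"] le b xy by (intro exI[of _ "1 - y"]) simp
  next
    case 2
    then show ?thesis using sides(2)[of "a + y"] le b xy by (intro exI[of _ "a + y"]) simp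
  next
    case 3
    then show ?thesis using sides(1)[of x] le b xy by (intro exI[of _ x]) simp
  next
    case 4
    then show ?thesis
      using sides(3)[of "1 / 2 + a - x"] le b xy by (intro exI[of _ "1 / 2 + a - x"]) simp
  qed
  then show "p \<in> range (boundary_point a)" by blast
qed

section \<open>Billiard motion as alternating reflections of the circle\<close>

text \<open>Motion along a diagonal preserves the difference or the sum of the coordinates, which
  leaves only the old parameter or its reflection. The old one is excluded because the first
  coordinate changes.\<close>

lemma boundary_point_step:
  assumes ab: "0 < a" "0 < b" "2 * (a + b) = 1"
    and v: "\<bar>fst v\<bar> = 1" "\<bar>snd v\<bar> = 1" and "r \<noteq> 0"
    and q: "q \<in> perimeter a b" "q = boundary_point a s + r *\<^sub>R v"
  shows "q = boundary_point a ((if fst v = snd v then 2 * a else 0) - s)"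
proof -
  have a: "a < 1 / 2" using ab by auto
  obtain s' where s': "q = boundary_point a s'"
    using q(1) range_boundary_point[OF ab] by blast
  have "fst q \<noteq> fst (boundary_point a s)" using q(2) \<open>r \<noteq> 0\<close> v by auto
  then have "s - s' \<notin> \<int>" using boundary_point_eq_iff[OF \<open>0 < a\<close> a] s' by metis
  show ?thesis
  proof (cases "fst v = snd v")
    case True
    then have "fst q - snd q = fst (boundary_point a s) - snd (boundary_point a s)"
      using q(2) by simp
    then have "sawtooth (s - a) = sawtooth (s' - a)"
      by (simp add: s' boundary_point_diff)
    then have "s + s' - 2 * a \<in> \<int>"
      using \<open>s - s' \<notin> \<int>\<close> by (simp add: sawtooth_eq_iff algebra_simps)
    then have "s' - (2 * a - s) \<in> \<int>" by (simp add: algebra_simps)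
    then show ?thesis using True s' boundary_point_eq_iff[OF \<open>0 < a\<close> a] by simp
  next
    case False
    then have "fst v + snd v = 0" using v by linarith
    then have "r * fst v + r * snd v = 0" by (metis distrib_left mult_zero_right)
    then have "fst q + snd q = fst (boundary_point a s) + snd (boundary_point a s)"
      using q(2) by simp
    then have "sawtooth s = sawtooth s'"
      by (simp add: s' boundary_point_sum)
    then have "s' - (0 - s) \<in> \<int>"
      using \<open>s - s' \<notin> \<int>\<close> by (simp add: sawtooth_eq_iff algebra_simps)
    then show ?thesis using False s' boundary_point_eq_iff[OF \<open>0 < a\<close> a] by simp
  qed
qed

text \<open>All three points lie on one line. If the way back were shorter or longer than the way
  out, \<open>z\<close> or \<open>x\<close> would be a frontier point inside a chord that runs
  through the interior. This excludes corners in the middle of an injective orbit.\<close>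

lemma billiard_turns_back:
  assumes v: "v \<noteq> (0 :: 'a :: euclidean_space)" and rs: "0 < r" "0 < s"
    and y: "y = x + r *\<^sub>R v" and z: "z = y + s *\<^sub>R (- v)"
    and xy: "open_segment x y \<subseteq> interior T" and yz: "open_segment y z \<subseteq> interior T"
    and fr: "x \<in> frontier T" "z \<in> frontier T"
  shows "z = x"
proof -
  have "x \<notin> interior T" "z \<notin> interior T" using fr by (auto simp: frontier_def)
  then have out: "z \<notin> open_segment x y" "x \<notin> open_segment y z" using xy yz by auto
  have zx: "z = x + (r - s) *\<^sub>R v" using y z by (simp add: algebra_simps)
  have "x \<noteq> y" "y \<noteq> z" using y z v rs by auto
  show ?thesis
  proof (cases r s rule: linorder_cases)
    case less
    have "x = (1 - r / s) *\<^sub>R y + (r / s) *\<^sub>R z"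
      using rs by (simp add: y z algebra_simps)
    moreover have "0 < r / s" "r / s < 1" using less rs by auto
    ultimately have "x \<in> open_segment y z" using \<open>y \<noteq> z\<close> by (auto simp: in_segment)
    then show ?thesis using out by blast
  next
    case equal
    then show ?thesis using zx by simp
  next
    case greater
    have "(1 - c) *\<^sub>R x + c *\<^sub>R y = x + (c * r) *\<^sub>R v" for c
      by (simp add: y algebra_simps)
    from this[of "(r - s) / r"]
    have "z = (1 - (r - s) / r) *\<^sub>R x + ((r - s) / r) *\<^sub>R y"
      using rs by (simp add: zx)
    moreover have "0 < (r - s) / r" "(r - s) / r < 1" using greater rs by auto
    ultimately have "z \<in> open_segment x y" using \<open>x \<noteq> y\<close> by (auto simp: in_segment)
    then show ?thesis using out by blast
  qed
qed

text \<open>Away from corners exactly one velocity component changes sign, so the two diagonal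
  directions alternate, and with them the two reflections of the circle.\<close>

lemma billiard_path_zigzag:
  assumes ab: "0 < a" "0 < b" "2 * (a + b) = 1"
    and path: "billiard_path a b F" and inj: "inj_on F {1..n}"
  obtains t where "zigzag t n" "\<And>k. k \<in> {1..n} \<Longrightarrow> F k = boundary_point a (t k)"
proof -
  have a: "a < 1 / 2" using ab by auto
  obtain v where F1: "F 1 \<in> perimeter a b" and v1: "\<bar>fst (v 1)\<bar> = 1" "\<bar>snd (v 1)\<bar> = 1"
    and fly: "\<And>k. 1 \<le> k \<Longrightarrow> \<exists>r>0. F (Suc k) = F k + r *\<^sub>R v k"
    and seg: "\<And>k. 1 \<le> k \<Longrightarrow> open_segment (F k) (F (Suc k)) \<subseteq> interior (table a b)"
    and per: "\<And>k. 1 \<le> k \<Longrightarrow> F (Suc k) \<in> perimeter a b"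
    and reb: "\<And>k. 1 \<le> k \<Longrightarrow> v (Suc k) = rebound a b (F (Suc k)) (v k)"
    using path unfolding billiard_path_def by metis
  have F_per: "F k \<in> perimeter a b" if "1 \<le> k" for k
    using F1 per[of "k - 1"] that by (cases "k = 1") auto
  have v: "\<bar>fst (v k)\<bar> = 1 \<and> \<bar>snd (v k)\<bar> = 1" if "1 \<le> k" for k
    using that
  proof (induction k rule: dec_induct)
    case (step k)
    then show ?case by (auto simp: reb rebound_def)
  qed (use v1 in auto)
  \<comment> \<open>The bound on \<open>k\<close> concerns only points before \<open>F n\<close>. At
    a corner among them the ball would return to \<open>F k\<close>, against injectivity.\<close>
  have turn: "(fst (v (Suc k)) = snd (v (Suc k))) \<longleftrightarrow> (fst (v k) \<noteq> snd (v k))"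
    if k: "1 \<le> k" "Suc (Suc k) \<le> n" for k
  proof -
    have "\<not> (fst (F (Suc k)) \<in> {0, a} \<and> snd (F (Suc k)) \<in> {0, b})"
    proof
      assume "fst (F (Suc k)) \<in> {0, a} \<and> snd (F (Suc k)) \<in> {0, b}"
      then have "v (Suc k) = - v k" by (auto simp: reb[OF k(1)] rebound_def prod_eq_iff)
      moreover obtain r where "0 < r" "F (Suc k) = F k + r *\<^sub>R v k" using fly k by blast
      moreover obtain s where "0 < s" "F (Suc (Suc k)) = F (Suc k) + s *\<^sub>R v (Suc k)"
        using fly[of "Suc k"] by auto
      moreover have "v k \<noteq> 0" using v[OF k(1)] by auto
      ultimately have "F (Suc (Suc k)) = F k"
        using billiard_turns_back[of "v k" r s "F (Suc k)" "F k" "F (Suc (Suc k))" "table a b"]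
          seg[OF k(1)] seg[of "Suc k"] F_per[OF k(1)] F_per[of "Suc (Suc k)"]
        by (auto simp: perimeter_def)
      then show False using inj_onD[OF inj, of "Suc (Suc k)" k] k by auto
    qed
    then have "v (Suc k) = (- fst (v k), snd (v k)) \<or> v (Suc k) = (fst (v k), - snd (v k))"
      using F_per[of "Suc k"] ab by (auto simp: reb[OF k(1)] rebound_def mem_perimeter_iff)
    then show ?thesis using v[OF k(1)] by auto
  qed
  define e where "e = (fst (v 1) = snd (v 1))"
  have dir: "(fst (v k) = snd (v k)) = (if odd k then e else \<not> e)" if "1 \<le> k" "k < n" for k
    using that
  proof (induction k rule: dec_induct)
    case base
    then show ?case by (simp add: e_def)
  next
    case (step k)
    then show ?case using turn[of k] by auto
  qed
  \<comment> \<open>The reflections used after odd and after even indices send \<open>x\<close> to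
    \<open>c - x\<close> and to \<open>d - x\<close>.\<close>
  define c d where "c = (if e then 2 * a else 0)" and "d = (if e then 0 else 2 * a)"
  obtain s where s: "F 1 = boundary_point a s"
    using F1 range_boundary_point[OF ab] by blast
  \<comment> \<open>Two steps from an odd index add \<open>d - c\<close>, which is therefore twice
    \<phi>. The other constants of \<open>t\<close> are fitted to the values \<open>s\<close> at 1
    and \<open>c - s\<close> at 2.\<close>
  define \<phi> where "\<phi> = (d - c) / 2"
  define t where "t k = (if odd k then (s - \<phi>) + real k * \<phi> else (c - s + 2 * \<phi>) - real k * \<phi>)"
    for k :: nat
  have t_Suc: "t (Suc k) = (if odd k then c else d) - t k" for k
    by (simp add: t_def \<phi>_def field_simps)
  have F: "F k = boundary_point a (t k)" if "k \<in> {1..n}" for k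
  proof -
    have "1 \<le> k" "k \<le> n" using that by auto
    then show ?thesis
    proof (induction k rule: dec_induct)
      case base
      have "t 1 = s" by (simp add: t_def)
      then show ?case by (simp only: s)
    next
      case (step k)
      then have IH: "F k = boundary_point a (t k)" and k: "1 \<le> k" "k < n" by auto
      obtain r where "0 < r" "F (Suc k) = F k + r *\<^sub>R v k" using fly k by blast
      then have "F (Suc k) = boundary_point a ((if fst (v k) = snd (v k) then 2 * a else 0) - t k)"
        using boundary_point_step[OF ab, of "v k" r "F (Suc k)" "t k"] v[OF k(1)] per[OF k(1)] IH
        by auto
      also have "(if fst (v k) = snd (v k) then 2 * a else 0) = (if odd k then c else d)"
        using dir[OF k] by (auto simp: c_def d_def)
      finally show ?case by (simp only: t_Suc)
    qed
  qed
  have "k = l" if "k \<in> {1..n}" "l \<in> {1..n}" "t k - t l \<in> \<int>" for k l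
    using that F boundary_point_eq_iff[OF \<open>0 < a\<close> a] inj_onD[OF inj] by metis
  then have "zigzag t n" unfolding zigzag_def using t_def by blast
  with F show thesis using that by blast
qed

section \<open>Segments and index pairs\<close>

locale billiard_orbit =
  fixes a b :: real and F :: "nat \<Rightarrow> real \<times> real" and n :: nat and t :: "nat \<Rightarrow> real"
  assumes ab: "0 < a" "0 < b" "2 * (a + b) = 1"
    and zigzag: "zigzag t n"
    and F: "k \<in> {1..n} \<Longrightarrow> F k = boundary_point a (t k)"
begin

sublocale circle_parametrization "boundary_point a" "perimeter a b"
proof
  have "a < 1 / 2" using ab by auto
  then show "boundary_point a s = boundary_point a s' \<longleftrightarrow> s - s' \<in> \<int>" for s s'
    using boundary_point_eq_iff ab by blast
qed (use continuous_on_boundary_point range_boundary_point[OF ab] in auto)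

definition side :: "nat \<times> nat \<Rightarrow> (real \<times> real) set" where
  "side = (\<lambda>(k, l). open_arc (t k) (t l))"

lemma F_eq_iff: "k \<in> {1..n} \<Longrightarrow> l \<in> {1..n} \<Longrightarrow> F k = F l \<longleftrightarrow> k = l"
  using zigzag_inj[OF zigzag, of k l] by (auto simp: F eq_iff)

lemma inj_F: "inj_on F {1..n}"
  by (auto intro: inj_onI simp: F_eq_iff)

lemma endpoints_side:
  assumes "k \<in> {1..n}" "l \<in> {1..n}" "k \<noteq> l"
  shows "endpoints (side (k, l)) = {F k, F l}"
proof -
  have "boundary_point a (t k) \<noteq> boundary_point a (t l)"
    using F_eq_iff assms F by metis
  then show ?thesis
    using closure_arc_minus assms F by (simp add: endpoints_def side_def)
qed

text \<open>Ordered pairs account for both arcs with given endpoints, as \<open>side (k, l)\<close>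
  and \<open>side (l, k)\<close>.\<close>

lemma segment_iff:
  "segment a b F n I \<longleftrightarrow> (\<exists>k\<in>{1..n}. \<exists>l\<in>{1..n}. k \<noteq> l \<and> I = side (k, l))"
proof
  assume I: "segment a b F n I"
  then obtain k l where k: "k \<in> {1..n}" and l: "l \<in> {1..n}"
    and ne: "F k \<noteq> F l" and "endpoints I = {F k, F l}"
    unfolding segment_def Phi_def by blast
  then have ends: "closure I - I = {boundary_point a (t k), boundary_point a (t l)}"
    by (simp add: endpoints_def F)
  have "boundary_point a (t k) \<noteq> boundary_point a (t l)" using ne k l by (simp add: F)
  then have "I = side (k, l) \<or> I = side (l, k)"
    using I open_connected_is_arc[OF _ _ ends] unfolding segment_def side_def by simp
  then show "\<exists>k\<in>{1..n}. \<exists>l\<in>{1..n}. k \<noteq> l \<and> I = side (k, l)"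
    using k l ne by metis
next
  assume "\<exists>k\<in>{1..n}. \<exists>l\<in>{1..n}. k \<noteq> l \<and> I = side (k, l)"
  then obtain k l where kl: "k \<in> {1..n}" "l \<in> {1..n}" "k \<noteq> l" and I: "I = side (k, l)" by blast
  have "openin (top_of_set (perimeter a b)) I" "connected I"
    using openin_arc connected_arc by (simp_all add: I side_def)
  moreover have "F k \<in> Phi F n" "F l \<in> Phi F n" "F k \<noteq> F l"
    using kl F_eq_iff by (auto simp: Phi_def)
  ultimately show "segment a b F n I"
    unfolding segment_def using endpoints_side[OF kl] I by blast
qed

lemma side_segment:
  "k \<in> {1..n} \<Longrightarrow> l \<in> {1..n} \<Longrightarrow> k \<noteq> l \<Longrightarrow> segment a b F n (side (k, l))"
  unfolding segment_iff by blast

lemma side_Int_Phi: "side (k, l) \<inter> Phi F n = F ` enclosed t n k l"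
proof -
  have "F m \<in> side (k, l) \<longleftrightarrow> m \<in> enclosed t n k l" if "m \<in> {1..n}" for m
    using that by (simp only: F side_def prod.case mem_arc_iff enclosed_def mem_Collect_eq simp_thms)
  then show ?thesis by (auto simp: Phi_def enclosed_def)
qed

lemma elementary_side_iff:
  assumes "k \<in> {1..n}" "l \<in> {1..n}" "k \<noteq> l"
  shows "elementary a b F n (side (k, l)) \<longleftrightarrow> adjacent t n k l"
  using assms side_segment[OF assms]
  by (simp add: elementary_def side_Int_Phi adjacent_iff_enclosed)

lemma odd_segment_side_iff:
  assumes "k \<in> {1..n}" "l \<in> {1..n}" "k \<noteq> l"
  shows "odd_segment a b F n (side (k, l)) \<longleftrightarrow> odd (k + l)"
proof
  assume "odd_segment a b F n (side (k, l))"
  then obtain i j where ij: "i \<in> {1..n}" "j \<in> {1..n}" "{F k, F l} = {F i, F j}" "even i \<longleftrightarrow> odd j"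
    unfolding odd_segment_def endpoints_side[OF assms] by blast
  then have "k = i \<and> l = j \<or> k = j \<and> l = i"
    using F_eq_iff assms unfolding doubleton_eq_iff by blast
  then show "odd (k + l)" using ij by auto
next
  assume "odd (k + l)"
  then have "even k \<longleftrightarrow> odd l" by simp
  then show "odd_segment a b F n (side (k, l))"
    unfolding odd_segment_def endpoints_side[OF assms] using side_segment[OF assms] assms by blast
qed

lemma associated_side_iff:
  assumes "k \<in> {1..n}" "l \<in> {1..n}" "k \<noteq> l" "S \<subseteq> {1..n}"
  shows "associated a b F n (F ` S) (side (k, l)) \<longleftrightarrow>
    enclosed t n k l = {} \<and> (k \<in> S \<or> l \<in> S) \<or> enclosed t n k l \<noteq> {} \<and> enclosed t n k l \<subseteq> S"
proof -
  have "enclosed t n k l \<subseteq> {1..n}" by (auto simp: enclosed_def)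
  then have "F ` enclosed t n k l \<subseteq> F ` S \<longleftrightarrow> enclosed t n k l \<subseteq> S"
    using inj_on_image_subset_iff[OF inj_F] assms(4) by blast
  moreover have "{F k, F l} \<inter> F ` S \<noteq> {} \<longleftrightarrow> k \<in> S \<or> l \<in> S"
    using inj_on_image_mem_iff[OF inj_F _ assms(4)] assms(1,2) by auto
  ultimately show ?thesis
    using side_segment[OF assms(1,2,3)] assms(1,2,3)
    unfolding associated_def elementary_side_iff[OF assms(1,2,3)] adjacent_iff_enclosed
      endpoints_side[OF assms(1,2,3)] side_Int_Phi
    by auto
qed

lemma odd_associated_eq:
  assumes "S \<subseteq> {1..n}"
  shows "odd_associated a b F n (F ` S) = side ` odd_pairs t n S"
proof (intro equalityI subsetI)
  fix I assume I: "I \<in> odd_associated a b F n (F ` S)"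
  then have "segment a b F n I" by (simp add: odd_associated_def odd_segment_def)
  then obtain k l where kl: "k \<in> {1..n}" "l \<in> {1..n}" "k \<noteq> l" "I = side (k, l)"
    unfolding segment_iff by blast
  then have "(k, l) \<in> odd_pairs t n S"
    using I assms by (simp add: odd_associated_def odd_segment_side_iff associated_side_iff odd_pairs_def)
  then show "I \<in> side ` odd_pairs t n S" using kl by blast
next
  fix I assume "I \<in> side ` odd_pairs t n S"
  then obtain k l where kl: "(k, l) \<in> odd_pairs t n S" and I: "I = side (k, l)" by auto
  then have "k \<in> {1..n}" "l \<in> {1..n}" "k \<noteq> l" by (auto simp: odd_pairs_def)
  then show "I \<in> odd_associated a b F n (F ` S)"
    using kl assms
    by (simp add: I odd_associated_def odd_segment_side_iff associated_side_iff odd_pairs_def)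
qed

text \<open>The endpoints recover the unordered pair. The two orders are told apart because the
  corresponding arcs are disjoint and nonempty.\<close>

lemma inj_side: "inj_on side {(k, l). k \<in> {1..n} \<and> l \<in> {1..n} \<and> k \<noteq> l}"
proof (rule inj_onI, clarify)
  fix k l i j
  assume kl: "k \<in> {1..n}" "l \<in> {1..n}" "k \<noteq> l" and ij: "i \<in> {1..n}" "j \<in> {1..n}" "i \<noteq> j"
    and eq: "side (k, l) = side (i, j)"
  have "{F k, F l} = {F i, F j}"
    using endpoints_side[OF kl] endpoints_side[OF ij] eq by simp
  then consider "k = i \<and> l = j" | "k = j \<and> l = i"
    using F_eq_iff kl ij unfolding doubleton_eq_iff by blast
  then show "k = i \<and> l = j"
  proof cases
    case 2
    then have "side (k, l) = {}"
      using arc_disjoint[of "t k" "t l"] eq by (simp add: side_def)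
    then show ?thesis
      using arc_nonempty[of "t k" "t l"] F_eq_iff[of k l] kl by (simp add: side_def F)
  qed
qed

lemma weight_side:
  assumes "k \<in> {1..n}" "l \<in> {1..n}" "k \<noteq> l"
  shows "weight F n (side (k, l)) = index_weight k l"
  using weight_eq[OF inj_F assms(1,2) endpoints_side[OF assms]] .

text \<open>Indices of equal parity have an even difference, so an odd weight can only be a sum of
  indices of different parity.\<close>

lemma index_weight_odd_iff: "odd w \<Longrightarrow> index_weight k l = w \<longleftrightarrow> k + l = w"
  by (auto simp: index_weight_def even_nat_iff)

lemma weights_side:
  assumes "X \<subseteq> {(k, l). k \<in> {1..n} \<and> l \<in> {1..n} \<and> odd (k + l)}"
  shows "weight F n ` side ` X = (\<lambda>(k, l). k + l) ` X"
proof -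
  have "weight F n (side p) = (case p of (k, l) \<Rightarrow> k + l)" if "p \<in> X" for p
  proof -
    obtain k l where p: "p = (k, l)" by (cases p)
    then have kl: "k \<in> {1..n}" "l \<in> {1..n}" "odd (k + l)" using assms that by auto
    then have "k \<noteq> l" by auto
    then show ?thesis using weight_side kl index_weight_odd_iff[OF kl(3)] p by simp
  qed
  then show ?thesis by (simp add: image_image)
qed

lemma card_elementary_of_weight:
  assumes "odd w"
  shows "card (elementary_of_weight a b F n w) = card (adjacent_pairs t n w)"
proof -
  have "elementary_of_weight a b F n w = side ` adjacent_pairs t n w"
  proof (intro equalityI subsetI)
    fix I assume I: "I \<in> elementary_of_weight a b F n w"
    then have "segment a b F n I" by (simp add: elementary_of_weight_def elementary_def)
    then obtain k l where kl: "k \<in> {1..n}" "l \<in> {1..n}" "k \<noteq> l" and "I = side (k, l)"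
      unfolding segment_iff by blast
    then show "I \<in> side ` adjacent_pairs t n w"
      using I weight_side[OF kl] index_weight_odd_iff[OF assms] elementary_side_iff[OF kl]
      by (auto simp: elementary_of_weight_def adjacent_pairs_def)
  next
    fix I assume "I \<in> side ` adjacent_pairs t n w"
    then obtain k l where adj: "adjacent t n k l" "k + l = w" and I: "I = side (k, l)"
      by (auto simp: adjacent_pairs_def)
    then have kl: "k \<in> {1..n}" "l \<in> {1..n}" "k \<noteq> l" by (auto simp: adjacent_def)
    then show "I \<in> elementary_of_weight a b F n w"
      using adj weight_side[OF kl] index_weight_odd_iff[OF assms] elementary_side_iff[OF kl]
      by (simp add: elementary_of_weight_def I)
  qed
  moreover have "inj_on side (adjacent_pairs t n w)"
    by (rule inj_on_subset[OF inj_side]) (auto simp: adjacent_pairs_def adjacent_def)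
  ultimately show ?thesis by (simp add: card_image)
qed

section \<open>The two cardinalities for the billiard table\<close>

lemma card_min_odd_weight:
  assumes n: "3 \<le> n" and w: "weight F n ` odd_associated a b F n {F 1} = {w\<^sub>1, w\<^sub>2}" "w\<^sub>1 < w\<^sub>2"
  shows "real (card (elementary_of_weight a b F n w\<^sub>1)) = (real w\<^sub>1 - 1) / 2"
proof -
  have "odd_associated a b F n {F 1} = side ` odd_pairs t n {1}"
    using odd_associated_eq[of "{1}"] n by simp
  then have "(\<lambda>(k, l). k + l) ` odd_pairs t n {1} = {w\<^sub>1, w\<^sub>2}"
    using w(1) weights_side[of "odd_pairs t n {1}"] by (auto simp: odd_pairs_def)
  then obtain q where q: "even q" "adjacent t n 1 q \<or> adjacent t n q 1" "w\<^sub>1 = q + 1"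
    using min_weight_first[OF n _ w(2)] by blast
  then have "card (elementary_of_weight a b F n w\<^sub>1) = q div 2"
    using card_elementary_of_weight[of w\<^sub>1] card_adjacent_pairs_first[OF zigzag n q(1,2)] by simp
  then show ?thesis using q by (simp add: real_of_nat_div)
qed

lemma card_max_odd_weight:
  assumes n: "3 \<le> n"
    and w: "weight F n ` (odd_associated a b F n {F 1, F n} - odd_associated a b F n {F 1})
      = {w\<^sub>3, w\<^sub>4}" "w\<^sub>3 < w\<^sub>4"
  shows "real (card (elementary_of_weight a b F n w\<^sub>4)) = real n - (real w\<^sub>4 - 1) / 2"
proof -
  have pairs: "odd_pairs t n S \<subseteq> {(k, l). k \<in> {1..n} \<and> l \<in> {1..n} \<and> odd (k + l)}" for S
    by (auto simp: odd_pairs_def)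
  have "odd_associated a b F n {F 1, F n} - odd_associated a b F n {F 1} =
      side ` odd_pairs t n {1, n} - side ` odd_pairs t n {1}"
    using odd_associated_eq[of "{1}"] odd_associated_eq[of "{1, n}"] n by simp
  \<comment> \<open>Distinct index pairs give distinct segments, so the difference can be formed
    among index pairs.\<close>
  also have "\<dots> = side ` (odd_pairs t n {1, n} - odd_pairs t n {1})"
  proof (rule inj_on_image_set_diff[OF inj_side, symmetric])
    have "{(k, l). k \<in> {1..n} \<and> l \<in> {1..n} \<and> odd (k + l)} \<subseteq> {(k, l). k \<in> {1..n} \<and> l \<in> {1..n} \<and> k \<noteq> l}"
      by auto
    then show "odd_pairs t n {1, n} - odd_pairs t n {1} \<subseteq> {(k, l). k \<in> {1..n} \<and> l \<in> {1..n} \<and> k \<noteq> l}"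
      "odd_pairs t n {1} \<subseteq> {(k, l). k \<in> {1..n} \<and> l \<in> {1..n} \<and> k \<noteq> l}"
      using pairs by blast+
  qed
  finally have img: "weight F n ` side ` (odd_pairs t n {1, n} - odd_pairs t n {1}) = {w\<^sub>3, w\<^sub>4}"
    using w(1) by simp
  have "odd_pairs t n {1, n} - odd_pairs t n {1} \<subseteq>
      {(k, l). k \<in> {1..n} \<and> l \<in> {1..n} \<and> odd (k + l)}"
    using pairs by blast
  from weights_side[OF this] img
  have "(\<lambda>(k, l). k + l) ` (odd_pairs t n {1, n} - odd_pairs t n {1}) = {w\<^sub>3, w\<^sub>4}"
    by (simp only:)
  then obtain v where v: "odd (n + v)" "adjacent t n n v \<or> adjacent t n v n" "w\<^sub>4 = n + v"
    using max_weight_last[OF zigzag n _ w(2)] by blast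
  have "v \<le> n" using v(2) by (auto simp: adjacent_def)
  moreover have "even (n + 1 - v)" using v(1) \<open>v \<le> n\<close> by auto
  moreover have "card (elementary_of_weight a b F n w\<^sub>4) = (n + 1 - v) div 2"
    using card_elementary_of_weight[of w\<^sub>4] card_adjacent_pairs_last[OF zigzag n v(1,2)] v by simp
  \<comment> \<open>With \<open>w\<^sub>4 = n + v\<close>, the claimed value
    \<open>n - (w\<^sub>4 - 1) / 2\<close> equals \<open>(n + 1 - v) / 2\<close>, and the integer
    division is exact by parity.\<close>
  ultimately show ?thesis using v by (simp add: real_of_nat_div of_nat_diff field_simps)
qed

end

theorem theorem2p2:
  fixes a b :: real and F :: "nat \<Rightarrow> real \<times> real"
    and n \<omega>\<^sub>0 \<omega>\<^sub>1 \<omega>\<^sub>2 \<omega>\<^sub>3 \<omega>\<^sub>4 :: nat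
    and A\<^sub>1 A\<^sub>4 :: "(real \<times> real) set set"
  assumes "a > 0" and "b > 0" and "2 * (a + b) = 1"
    and "billiard_path a b F"
    and "n \<ge> 5" and "inj_on F {1..n}"
    and "weight F n ` odd_associated a b F n {F 1} = {\<omega>\<^sub>1, \<omega>\<^sub>2}" and "\<omega>\<^sub>1 < \<omega>\<^sub>2"
    and "weight F n ` even_associated a b F n {F 1} = {\<omega>\<^sub>0}"
    and "weight F n ` (odd_associated a b F n {F 1, F n} - odd_associated a b F n {F 1})
           = {\<omega>\<^sub>3, \<omega>\<^sub>4}" and "\<omega>\<^sub>3 < \<omega>\<^sub>4"
    and "A\<^sub>1 = elementary_of_weight a b F n \<omega>\<^sub>1"
    and "A\<^sub>4 = elementary_of_weight a b F n \<omega>\<^sub>4"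
  shows "real (card A\<^sub>1) = (real \<omega>\<^sub>1 - 1) / 2 \<and>
         real (card A\<^sub>4) = real n - (real \<omega>\<^sub>4 - 1) / 2"
proof -
  obtain t where "zigzag t n" "\<And>k. k \<in> {1..n} \<Longrightarrow> F k = boundary_point a (t k)"
    using billiard_path_zigzag[OF assms(1,2,3,4,6)] by blast
  then interpret billiard_orbit a b F n t
    using assms(1,2,3) by unfold_locales
  have "3 \<le> n" using \<open>n \<ge> 5\<close> by simp
  then show ?thesis
    using card_min_odd_weight[OF _ assms(7,8)] card_max_odd_weight[OF _ assms(10,11)] assms(12,13)
    by simp
qed

end
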